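(* $c_{0,3} = 1$, $c_{1,3} = 2$, $c_{2,3} = 6$, $c_{3,3} = 18$, $c_{4,3} = 52$, $c_{5,3}=150$, and $c_{6,3}=450$.
   Context: $[3]^n$ is the set of words of length $n$ over the alphabet $\{1,2,3\}$. A combinatorial line in $[3]^n$ is a set $\{w(1),w(2),w(3)\}$, where $w \in (\{1,2,3\}\cup\{x\})^n$ is a word containing the wildcard $x$ at least once, and $w(i)$ is obtained from $w$ by replacing every occurrence of $x$ by $i$. A set $A \subset [3]^n$ is line-free if it contains no combinatorial line as a subset. $c_{n,3}$ denotes the maximum cardinality of a line-free subset of $[3]^n$. *)

theory Defs
  imports Main
begin

definition cube :: "nat \<Rightarrow> nat list set" where
  "cube n = {u. length u = n \<and> set u \<subseteq> {1, 2, 3}}"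

text \<open>Words over the alphabet extended by the wildcard \<open>x\<close>: \<open>Some a\<close> is the letter \<open>a\<close>,
  and \<open>None\<close> is the wildcard, which has to occur at least once.\<close>

definition templates :: "nat \<Rightarrow> nat option list set" where
  "templates n = {w. length w = n \<and> set w \<subseteq> insert None (Some ` {1, 2, 3}) \<and> None \<in> set w}"

definition subst_wildcard :: "nat option list \<Rightarrow> nat \<Rightarrow> nat list" where
  "subst_wildcard w i = map (\<lambda>s. case s of None \<Rightarrow> i | Some a \<Rightarrow> a) w"

definition combinatorial_line :: "nat \<Rightarrow> nat list set \<Rightarrow> bool" where
  "combinatorial_line n L \<longleftrightarrow>
     (\<exists>w \<in> templates n. L = {subst_wildcard w 1, subst_wildcard w 2, subst_wildcard w 3})"

definition line_free :: "nat \<Rightarrow> nat list set \<Rightarrow> bool" where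
  "line_free n A \<longleftrightarrow> A \<subseteq> cube n \<and> \<not> (\<exists>L. combinatorial_line n L \<and> L \<subseteq> A)"

text \<open>The \<open>Max\<close> is over a finite nonempty set: \<open>cube n\<close> is finite and the empty set is line-free.\<close>

definition c3 :: "nat \<Rightarrow> nat" where
  "c3 n = Max {card A | A. line_free n A}"

end

theory Submission
  imports Defs "HOL-Combinatorics.Multiset_Permutations"
begin

text \<open>
  Call the sum of the letters of a word modulo 3 its residue. Along a line with \<open>r\<close> wildcards the
  residue changes by \<open>r\<close> at each step, so a line whose number of wildcards is not divisible by 3
  meets all three residues. A set that avoids one residue therefore contains only lines with 3 or 6
  wildcards, and deleting a few nearly constant words removes those as well. This gives line-free
  sets of all the stated sizes.

  For the upper bounds, cutting a cube into three parallel faces shows that the maximum at most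
  triples from one dimension to the next; this gives 2, 6, 18 and, once 150 is known, 450. The
  bounds 52 and 150 rest on a converse to the construction: large line-free sets avoid a residue.
  In dimension 3 this holds from 17 points on (\<open>seventeen_points_avoid_residue\<close>), in dimension 4
  from 50 points on, up to an exceptional family of sets of size 50 (\<open>fifty_points_dim4\<close>).

  The passage from one dimension to the next is always the same. A line-free set \<open>A\<close> that is too large
  has, in every direction, large faces, which avoid a residue by the classification one dimension
  lower. Large faces in different directions overlap in so many points that they must avoid the
  same residue \<open>j\<close> (\<open>uniform_residue\<close>). The words of \<open>A\<close> of residue \<open>j\<close> are thus confined to the
  part of the cube outside all these faces. Each of them is expensive: every line through it with 1, 2, 4 or 5
  wildcards has its other two points outside residue \<open>j\<close>, and one of the two is missing from \<open>A\<close>.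
  Counting pairwise disjoint sets that each contain a missing word (\<open>pack_le_card\<close>) shows that the
  loss exceeds the gain.

  In dimension 5 one case remains, where exceptional four-dimensional faces occur. They determine each
  other's shape so strictly that such faces occur in all five directions, at the same letter, and
  the words which they force into \<open>A\<close> leave room for only 48 points in the third parallel face
  (\<open>card_third_face\<close>), whereas at least 49 are needed.

  The finite parts of these arguments are stated as closed executable propositions and are proved by
  rewriting with the defining equations.
\<close>

section \<open>Words and lines\<close>

fun words :: "nat \<Rightarrow> nat list list" where
  "words 0 = [[]]"
| "words (Suc n) = concat (map (\<lambda>a. map ((#) a) (words n)) [1, 2, 3])"

lemma set_words: "set (words n) = cube n"
proof (induction n)
  case 0
  show ?case by (auto simp: cube_def)
next
  case (Suc n)
  have "v \<in> cube (Suc n) \<longleftrightarrow> (\<exists>a u. v = a # u \<and> a \<in> {1, 2, 3} \<and> u \<in> cube n)" for v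
    by (cases v) (auto simp: cube_def)
  then show ?case using Suc by auto
qed

lemma distinct_words: "distinct (words n)"
  by (induction n) (auto simp: distinct_map)

lemma finite_cube: "finite (cube n)"
  by (metis List.finite_set set_words)

lemma length_words: "length (words n) = 3 ^ n"
  by (induction n) auto

lemma card_cube: "card (cube n) = 3 ^ n"
  by (metis distinct_card distinct_words length_words set_words)

lemma card_filter_words: "card {v \<in> cube n. P v} = length (filter P (words n))"
  by (metis distinct_card distinct_filter distinct_words set_filter set_words)

lemma cube_length: "v \<in> cube n \<Longrightarrow> length v = n"
  by (simp add: cube_def)

lemma cube_nth: "v \<in> cube n \<Longrightarrow> k < n \<Longrightarrow> v ! k \<in> {1, 2, 3}"
  unfolding cube_def using nth_mem by blast

lemma line_free_subset: "line_free n A \<Longrightarrow> A \<subseteq> cube n"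
  by (simp add: line_free_def)

text \<open>The points are kept in a list so that lines can be enumerated by rewriting.\<close>
definition line_points :: "nat option list \<Rightarrow> nat list list" where
  "line_points w = map (subst_wildcard w) [1, 2, 3]"

lemma line_free_iff:
  "line_free n A \<longleftrightarrow> A \<subseteq> cube n \<and> (\<forall>w \<in> templates n. \<not> set (line_points w) \<subseteq> A)"
  by (auto simp: line_free_def combinatorial_line_def line_points_def)

lemma line_free_missing:
  assumes "line_free n A" "w \<in> templates n"
  obtains x where "x \<in> set (line_points w)" "x \<notin> A"
  using assms by (auto simp: line_free_iff)

lemma c3_eqI:
  assumes "line_free n A" "card A = m" and ub: "\<And>B. line_free n B \<Longrightarrow> card B \<le> m"
  shows "c3 n = m"
proof -
  have "{card A | A. line_free n A} \<subseteq> {..m}" using ub by auto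
  then have "finite {card A | A. line_free n A}" by (rule finite_subset) simp
  then show ?thesis unfolding c3_def using assms by (intro Max_eqI) auto
qed

lemma line_points_in_cube:
  assumes "w \<in> templates n"
  shows "set (line_points w) \<subseteq> cube n"
proof -
  have "subst_wildcard w i \<in> cube n" if "i \<in> {1, 2, 3}" for i
    using assms that by (fastforce simp: templates_def cube_def subst_wildcard_def split: option.splits)
  then show ?thesis by (auto simp: line_points_def)
qed

text \<open>A line through \<open>v\<close> arises by turning some, but not necessarily all, of the occurrences of one
  letter \<open>e\<close> of \<open>v\<close> into wildcards.\<close>
fun generalize :: "nat \<Rightarrow> nat list \<Rightarrow> nat option list list" where
  "generalize e [] = [[]]"
| "generalize e (a # v) = map ((#) (Some a)) (generalize e v) @
     (if a = e then map ((#) None) (generalize e v) else [])"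

definition lines_through :: "nat list \<Rightarrow> nat option list list" where
  "lines_through v = filter (\<lambda>w. None \<in> set w) (concat (map (\<lambda>e. generalize e v) [1, 2, 3]))"

lemma generalize_shape:
  "w \<in> set (generalize e v) \<Longrightarrow> length w = length v \<and> set w \<subseteq> insert None (Some ` set v)"
  by (induction v arbitrary: w) (fastforce split: if_splits)+

lemma lines_through_templates:
  "v \<in> cube n \<Longrightarrow> w \<in> set (lines_through v) \<Longrightarrow> w \<in> templates n"
  using generalize_shape by (fastforce simp: lines_through_def templates_def cube_def)

text \<open>If the points satisfying \<open>K\<close> belong to a line-free set, then a point \<open>z\<close> that completes a
  line consisting otherwise of such points is excluded from the set. This removes the excluded
  points from a list of candidates.\<close>
definition unblocked :: "(nat list \<Rightarrow> bool) \<Rightarrow> nat list list \<Rightarrow> nat list list" where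
  "unblocked K zs =
     filter (\<lambda>z. \<not> list_ex (\<lambda>w. list_all (\<lambda>x. x = z \<or> K x) (line_points w)) (lines_through z)) zs"

lemma mem_unblocked:
  assumes lf: "line_free n A" and K: "\<And>x. x \<in> cube n \<Longrightarrow> K x \<Longrightarrow> x \<in> A" and z: "z \<in> A" "z \<in> set zs"
  shows "z \<in> set (unblocked K zs)"
proof -
  have "\<not> list_all (\<lambda>x. x = z \<or> K x) (line_points w)" if "w \<in> set (lines_through z)" for w
  proof -
    have w: "w \<in> templates n" using lf z that line_free_subset lines_through_templates by blast
    obtain x where "x \<in> set (line_points w)" "x \<notin> A" using line_free_missing[OF lf w] .
    moreover have "x \<noteq> z \<and> \<not> K x" using calculation K z line_points_in_cube[OF w] by blast
    ultimately show ?thesis by (auto simp: list_all_iff)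
  qed
  then show ?thesis using z by (auto simp: unblocked_def list_ex_iff)
qed

section \<open>Faces and slices\<close>

definition ins :: "nat \<Rightarrow> 'a \<Rightarrow> 'a list \<Rightarrow> 'a list" where
  "ins k a v = take k v @ a # drop k v"

definition del :: "nat \<Rightarrow> 'a list \<Rightarrow> 'a list" where
  "del k v = take k v @ drop (Suc k) v"

definition face :: "nat \<Rightarrow> 'a \<Rightarrow> 'a list set \<Rightarrow> 'a list set" where
  "face k a A = {v \<in> A. v ! k = a}"

text \<open>A face stays inside the cube, which is convenient for comparing different directions; the
  corresponding slice drops the constant coordinate and thus lives one dimension lower, where the
  classification of smaller sets applies.\<close>
definition slice :: "nat \<Rightarrow> 'a \<Rightarrow> 'a list set \<Rightarrow> 'a list set" where
  "slice k a A = {v. ins k a v \<in> A}"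

lemma ins_del: "k < length v \<Longrightarrow> ins k (v ! k) (del k v) = v"
  by (simp add: ins_def del_def id_take_nth_drop[symmetric])

lemma del_ins: "k \<le> length v \<Longrightarrow> del k (ins k a v) = v"
  by (simp add: ins_def del_def)

lemma length_ins: "length (ins k a v) = Suc (length v)"
  by (simp add: ins_def)

lemma set_ins: "set (ins k a v) = insert a (set v)"
  by (metis append_take_drop_id ins_def list.simps(15) set_append Un_insert_right)

lemma sum_list_ins: "sum_list (ins k a v) = a + sum_list (v :: nat list)"
proof -
  have "sum_list v = sum_list (take k v) + sum_list (drop k v)"
    by (metis append_take_drop_id sum_list_append)
  then show ?thesis by (simp add: ins_def)
qed

lemma nth_ins:
  assumes "k \<le> length v" "i \<noteq> k" "i \<le> length v"
  shows "ins k a v ! i = v ! (if i < k then i else i - 1)"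
  using assms by (auto simp: ins_def nth_append nth_Cons' min_def)

lemma nth_ins_same: "k \<le> length v \<Longrightarrow> ins k a v ! k = a"
  by (simp add: ins_def nth_append)

lemma slice_in_cube: "A \<subseteq> cube n \<Longrightarrow> slice k a A \<subseteq> cube (n - 1)"
  by (fastforce simp: slice_def cube_def length_ins set_ins)

lemma face_subset: "face k a A \<subseteq> A"
  by (auto simp: face_def)

lemma face_eq_image:
  assumes "A \<subseteq> cube n" "k < n"
  shows "face k a A = ins k a ` slice k a A"
proof
  show "face k a A \<subseteq> ins k a ` slice k a A"
  proof
    fix v assume v: "v \<in> face k a A"
    then have "v = ins k a (del k v)" using assms ins_del[of k v] cube_length[of v n] by (auto simp: face_def)
    then show "v \<in> ins k a ` slice k a A" using v by (auto simp: face_def slice_def)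
  qed
  show "ins k a ` slice k a A \<subseteq> face k a A"
    using slice_in_cube[OF assms(1), of k a] assms(2) cube_length[of _ "n - 1"]
    by (fastforce simp: face_def slice_def nth_ins_same)
qed

lemma inj_on_ins: "k < n \<Longrightarrow> B \<subseteq> cube (n - 1) \<Longrightarrow> inj_on (ins k a) B"
  by (rule inj_on_inverseI[of _ "del k"]) (auto simp: del_ins cube_def)

lemma card_face:
  assumes "A \<subseteq> cube n" "k < n"
  shows "card (face k a A) = card (slice k a A)"
  using face_eq_image[OF assms] card_image[OF inj_on_ins[OF assms(2) slice_in_cube[OF assms(1)]]]
  by metis

text \<open>Inserting the fixed letter into a template turns a line of the slice into a line of the whole
  set.\<close>
lemma line_free_slice:
  assumes lf: "line_free n A" and k: "k < n" and a: "a \<in> {1, 2, 3}"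
  shows "line_free (n - 1) (slice k a A)"
  unfolding line_free_iff
proof (intro conjI ballI notI)
  show "slice k a A \<subseteq> cube (n - 1)" using slice_in_cube lf line_free_subset by blast
next
  fix w assume w: "w \<in> templates (n - 1)" and sub: "set (line_points w) \<subseteq> slice k a A"
  have "subst_wildcard (ins k (Some a) w) i = ins k a (subst_wildcard w i)" for i
    by (simp add: subst_wildcard_def ins_def take_map drop_map)
  then have "set (line_points (ins k (Some a) w)) \<subseteq> A"
    using sub by (auto simp: line_points_def slice_def)
  moreover have "ins k (Some a) w \<in> templates n"
    using w a k by (auto simp: templates_def length_ins set_ins)
  ultimately show False using lf line_free_iff by blast
qed

lemma card_faces:
  assumes "A \<subseteq> cube n" "k < n"
  shows "card A = card (face k 1 A) + card (face k 2 A) + card (face k 3 A)"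
proof -
  have fin: "finite (face k a A)" for a
    using assms(1) finite_cube finite_subset face_subset by (metis (no_types, lifting))
  have "A = face k 1 A \<union> face k 2 A \<union> face k 3 A"
    using assms cube_nth[of _ n k] by (auto simp: face_def)
  then have "card A = card (face k 1 A \<union> face k 2 A \<union> face k 3 A)" by simp
  also have "\<dots> = card (face k 1 A \<union> face k 2 A) + card (face k 3 A)"
    by (rule card_Un_disjoint) (use fin in \<open>auto simp: face_def\<close>)
  also have "card (face k 1 A \<union> face k 2 A) = card (face k 1 A) + card (face k 2 A)"
    by (rule card_Un_disjoint) (use fin in \<open>auto simp: face_def\<close>)
  finally show ?thesis .
qed

lemma card_faces_le:
  assumes "A \<subseteq> cube n" "k < n" "a \<in> {1, 2, 3}" "\<And>b. b \<in> {1, 2, 3} \<Longrightarrow> card (face k b A) \<le> c"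
  shows "card A \<le> card (face k a A) + 2 * c"
proof -
  have "card (face k 1 A) \<le> c" "card (face k 2 A) \<le> c" "card (face k 3 A) \<le> c"
    using assms(4) by auto
  then show ?thesis using card_faces[OF assms(1,2)] assms(3) by auto
qed

lemma card_face_le:
  assumes "line_free n A" "k < n" "a \<in> {1, 2, 3}" "\<And>B. line_free (n - 1) B \<Longrightarrow> card B \<le> c"
  shows "card (face k a A) \<le> c"
  using assms card_face[of A n k a] line_free_slice[of n A k a] line_free_subset[of n A] by metis

lemma card_le_three_times:
  assumes "line_free n A" "0 < n" "\<And>B. line_free (n - 1) B \<Longrightarrow> card B \<le> c"
  shows "card A \<le> 3 * c"
proof -
  have le: "card (face 0 b A) \<le> c" if "b \<in> {1, 2, 3}" for b
    using card_face_le[OF assms(1,2) that assms(3)] .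
  have "card A \<le> card (face 0 1 A) + 2 * c"
    by (rule card_faces_le[OF line_free_subset[OF assms(1)] assms(2)]) (use le in auto)
  with le[of 1] show ?thesis by simp
qed

text \<open>The shift of the index is hidden in the existential: deleting coordinate \<open>k\<close> moves the later
  coordinates by one, but only the size of the double face matters.\<close>
lemma card_face_of_face:
  assumes A: "A \<subseteq> cube n" and ki: "k < n" "i < n" "i \<noteq> k"
  obtains i' where "i' < n - 1" "card (face i b (face k a A)) = card (face i' b (slice k a A))"
proof
  let ?i' = "if i < k then i else i - 1"
  have S: "slice k a A \<subseteq> cube (n - 1)" using slice_in_cube[OF A] .
  have nth: "ins k a v ! i = v ! ?i'" if "v \<in> slice k a A" for v
    using nth_ins[of k v i a] S that ki cube_length[of v "n - 1"] by fastforce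
  have "face i b (face k a A) = {v \<in> ins k a ` slice k a A. v ! i = b}"
    using face_eq_image[OF A ki(1)] by (simp add: face_def)
  also have "\<dots> = ins k a ` face ?i' b (slice k a A)"
    using nth by (auto simp: face_def)
  finally have "face i b (face k a A) = ins k a ` face ?i' b (slice k a A)" .
  moreover have "inj_on (ins k a) (face ?i' b (slice k a A))"
    by (rule inj_on_subset[OF inj_on_ins[OF ki(1) S] face_subset])
  ultimately show "card (face i b (face k a A)) = card (face ?i' b (slice k a A))"
    by (simp add: card_image)
  show "?i' < n - 1" using ki by auto
qed

section \<open>Residues\<close>

definition residue :: "nat list \<Rightarrow> nat" where "residue v = sum_list v mod 3"

definition avoids :: "nat \<Rightarrow> nat list set \<Rightarrow> bool" where
  "avoids j A \<longleftrightarrow> (\<forall>v \<in> A. residue v \<noteq> j)"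

lemma residue_less: "residue v < 3" by (simp add: residue_def)

lemma residue_ins: "residue (ins k a v) = (a + residue v) mod 3"
  by (simp add: residue_def sum_list_ins mod_add_right_eq)

text \<open>Modulo 3 the letter \<open>2 * a\<close> is the negative of \<open>a\<close>, so no truncated subtraction is needed when a
  residue is transferred between a face and its slice.\<close>
lemma mod3_cancel: "(((r::nat) + a) mod 3 + 2 * a) mod 3 = r mod 3" "(a + (r + 2 * a) mod 3) mod 3 = r mod 3"
proof -
  have "(((r::nat) + a) mod 3 + 2 * a) mod 3 = (r + 3 * a) mod 3"
    by (simp add: mod_add_left_eq)
  then show "(((r::nat) + a) mod 3 + 2 * a) mod 3 = r mod 3" by simp
  have "(a + (r + 2 * a) mod 3) mod 3 = (r + 3 * a) mod 3"
    by (simp add: mod_add_right_eq)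
  then show "(a + (r + 2 * a) mod 3) mod 3 = r mod 3" by simp
qed

lemma residue_ins_iff:
  assumes "r < 3"
  shows "residue (ins k a v) = r \<longleftrightarrow> residue v = (r + 2 * a) mod 3"
proof
  assume "residue (ins k a v) = r"
  then have "(r + 2 * a) mod 3 = ((residue v + a) mod 3 + 2 * a) mod 3"
    by (simp add: residue_ins add.commute)
  then show "residue v = (r + 2 * a) mod 3"
    using mod3_cancel(1)[of "residue v" a] by (simp add: residue_def)
next
  assume "residue v = (r + 2 * a) mod 3"
  then show "residue (ins k a v) = r"
    using mod3_cancel(2)[of a r] assms by (simp add: residue_ins)
qed

lemma slice_avoids_iff:
  assumes "A \<subseteq> cube n" "k < n" "j < 3"
  shows "avoids ((j + 2 * a) mod 3) (slice k a A) \<longleftrightarrow> avoids j (face k a A)"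
  using residue_ins_iff[OF assms(3)] face_eq_image[OF assms(1,2)] by (simp add: avoids_def)

lemma face_avoids_of_slice:
  assumes "A \<subseteq> cube n" "k < n" "j < 3" "avoids j (slice k a A)"
  shows "avoids ((j + a) mod 3) (face k a A)"
proof -
  have "((j + a) mod 3 + 2 * a) mod 3 = j" using assms(3) mod3_cancel(1)[of j a] by simp
  then show ?thesis using slice_avoids_iff[OF assms(1,2), of "(j + a) mod 3" a] assms(4) by simp
qed

lemma slice_residue_class:
  assumes "a \<in> {1, 2, 3}" "r < 3" "0 < n"
  shows "slice k a {v \<in> cube n. residue v = r} = {v \<in> cube (n - 1). residue v = (r + 2 * a) mod 3}"
  using assms by (auto simp: slice_def residue_ins_iff cube_def length_ins set_ins)

lemma card_residue_class:
  assumes "r < 3" "0 < n"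
  shows "card {v \<in> cube n. residue v = r} = 3 ^ (n - 1)"
  using assms
proof (induction n arbitrary: r)
  case (Suc n)
  let ?C = "\<lambda>n r. {v \<in> cube n. residue v = r}"
  have C: "card (face 0 a (?C (Suc n) r)) = card (?C n ((r + 2 * a) mod 3))" if "a \<in> {1, 2, 3}" for a
    using card_face[of "?C (Suc n) r" "Suc n" 0 a] slice_residue_class[OF that Suc.prems] by auto
  have eq: "card (?C (Suc n) r) = card (?C n ((r + 2) mod 3)) + card (?C n ((r + 4) mod 3)) + card (?C n ((r + 6) mod 3))"
    using card_faces[of "?C (Suc n) r" "Suc n" 0] C[of 1] C[of 2] C[of 3] by simp
  show ?case
  proof (cases "n = 0")
    case True
    have "r = 0 \<or> r = 1 \<or> r = 2" using Suc.prems by linarith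
    then show ?thesis unfolding card_filter_words True by (auto simp: residue_def)
  next
    case False
    then have "card (?C n r') = 3 ^ (n - 1)" if "r' < 3" for r' using Suc.IH that by simp
    moreover have "(3::nat) ^ n = 3 * 3 ^ (n - 1)" using False by (simp flip: power_Suc)
    ultimately show ?thesis using eq by simp
  qed
qed simp

lemma card_avoiding_class:
  assumes "j < 3" "0 < n"
  shows "card {v \<in> cube n. residue v \<noteq> j} = 2 * 3 ^ (n - 1)"
proof -
  have "{v \<in> cube n. residue v \<noteq> j} = cube n - {v \<in> cube n. residue v = j}" by auto
  then have "card {v \<in> cube n. residue v \<noteq> j} = 3 ^ n - 3 ^ (n - 1)"
    using card_Diff_subset[of "{v \<in> cube n. residue v = j}" "cube n"] finite_cube[of n]
      card_residue_class[OF assms] card_cube[of n] by auto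
  moreover have "(3::nat) ^ n = 3 * 3 ^ (n - 1)" using assms by (simp flip: power_Suc)
  ultimately show ?thesis by simp
qed

text \<open>If two faces in different directions avoided different residues, their intersection would
  consist of words of the third residue, of which a cube of dimension \<open>n - 2\<close> has only
  \<open>3 ^ (n - 3)\<close>. But the intersection is large, because the two other parallel parts of the first
  face hold at most \<open>c\<close> points each.\<close>
lemma common_residue:
  assumes lf: "line_free n A" and n: "3 \<le> n" and ki: "k < n" "i < n" "i \<noteq> k"
    and ab: "a \<in> {1, 2, 3}" "b \<in> {1, 2, 3}"
    and bound: "\<And>B. line_free (n - 2) B \<Longrightarrow> card B \<le> c"
    and big: "2 * c + 3 ^ (n - 3) < card (face k a A)"
    and av: "avoids j (face k a A)" "avoids j' (face i b A)" and j: "j < 3" "j' < 3"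
  shows "j = j'"
proof (rule ccontr)
  assume ne: "j \<noteq> j'"
  \<comment> \<open>The third residue, since the residues 0, 1 and 2 add up to 3.\<close>
  define r where "r = 3 - j - j'"
  have r: "r < 3" using j ne by (auto simp: r_def)
  have other: "residue v = r" if "residue v \<noteq> j" "residue v \<noteq> j'" for v
    using that residue_less[of v] j ne by (auto simp: r_def)
  let ?C = "{v \<in> cube n. residue v = r}"
  have A: "A \<subseteq> cube n" using lf line_free_subset by blast
  have lfs: "line_free (n - 1) (slice k a A)" using line_free_slice[OF lf ki(1) ab(1)] .
  have faces: "card (face i e (face k a A)) \<le> c" if "e \<in> {1, 2, 3}" for e
  proof -
    obtain i' where i': "i' < n - 1"
      "card (face i e (face k a A)) = card (face i' e (slice k a A))"
      using card_face_of_face[OF A ki] .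
    have "card (face i' e (slice k a A)) \<le> c"
      by (rule card_face_le[OF lfs i'(1) that]) (use bound n in \<open>simp add: numeral_2_eq_2\<close>)
    then show ?thesis using i'(2) by simp
  qed
  have "card (face k a A) \<le> card (face i b (face k a A)) + 2 * c"
    by (rule card_faces_le[OF order.trans[OF face_subset A] ki(2) ab(2) faces])
  moreover have "card (face i b (face k a A)) \<le> 3 ^ (n - 3)"
  proof -
    have "face i b (face k a A) \<subseteq> face i b (face k a ?C)"
      using other av A unfolding face_def avoids_def by blast
    then have le: "card (face i b (face k a A)) \<le> card (face i b (face k a ?C))"
      by (rule card_mono[rotated]) (simp add: face_def finite_cube)
    obtain i' where i': "i' < n - 1"
      "card (face i b (face k a ?C)) = card (face i' b (slice k a ?C))"
      using card_face_of_face[of ?C n k i b a] ki by auto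
    let ?C' = "{v \<in> cube (n - 1). residue v = (r + 2 * a) mod 3}"
    have "card (face i' b ?C') = card (slice i' b ?C')"
      by (rule card_face[OF _ i'(1)]) auto
    also have "slice i' b ?C' = {v \<in> cube (n - 1 - 1). residue v = ((r + 2 * a) mod 3 + 2 * b) mod 3}"
      by (rule slice_residue_class[OF ab(2)]) (use n in auto)
    also have "card \<dots> = 3 ^ (n - 1 - 1 - 1)"
      by (rule card_residue_class) (use n in auto)
    also have "n - 1 - 1 - 1 = n - 3" by simp
    finally have "card (face i' b ?C') = 3 ^ (n - 3)" .
    moreover have "slice k a ?C = ?C'"
      by (rule slice_residue_class[OF ab(1) r]) (use n in auto)
    ultimately show ?thesis using le i'(2) by metis
  qed
  ultimately show False using big by linarith
qed

text \<open>Any two large faces in the same direction can be compared through a third one in another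
  direction, so a single residue serves all large faces.\<close>
lemma uniform_residue:
  assumes lf: "line_free n A" and n: "3 \<le> n"
    and bound: "\<And>B. line_free (n - 2) B \<Longrightarrow> card B \<le> c" and M: "2 * c + 3 ^ (n - 3) < M"
    and ex: "\<And>k. k < n \<Longrightarrow> \<exists>a \<in> {1, 2, 3}. \<exists>j < 3. M \<le> card (face k a A) \<and> avoids j (face k a A)"
  obtains j where "j < 3"
    "\<And>k a j'. k < n \<Longrightarrow> a \<in> {1, 2, 3} \<Longrightarrow> M \<le> card (face k a A) \<Longrightarrow> j' < 3 \<Longrightarrow> avoids j' (face k a A)
      \<Longrightarrow> avoids j (face k a A)"
proof -
  have eq: "j = j'" if "k < n" "i < n" "i \<noteq> k" "a \<in> {1, 2, 3}" "b \<in> {1, 2, 3}" "M \<le> card (face k a A)"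
    "avoids j (face k a A)" "avoids j' (face i b A)" "j < 3" "j' < 3" for k i a b j j'
    by (rule common_residue[OF lf n that(1-5) bound _ that(7-10)]) (use M that(6) in auto)
  obtain a j where 0: "a \<in> {1, 2, 3}" "j < 3" "M \<le> card (face 0 a A)" "avoids j (face 0 a A)"
    using ex[of 0] n by auto
  obtain b i where 1: "b \<in> {1, 2, 3}" "i < 3" "M \<le> card (face 1 b A)" "avoids i (face 1 b A)"
    using ex[of 1] n by auto
  have "i = j" using eq[of 1 0 b a i j] 0 1 n by simp
  show ?thesis
  proof
    show "j < 3" using 0 by simp
    fix k a' j' assume k: "k < n" "a' \<in> {1, 2, 3}" "M \<le> card (face k a' A)" "j' < 3" "avoids j' (face k a' A)"
    have "j' = j"
    proof (cases "k = 0")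
      case True
      then show ?thesis using eq[of k 1 a' b j' i] k 1 n \<open>i = j\<close> by simp
    next
      case False
      then show ?thesis using eq[of k 0 a' a j' j] k 0 n by simp
    qed
    then show "avoids j (face k a' A)" using k by simp
  qed
qed

section \<open>Hitting sets\<close>

text \<open>The greedy number of pairwise disjoint sets, starting with the points \<open>used\<close> already covered.
  It bounds the size of every hitting set from below, although it depends on the order of the list
  and need not be the largest possible bound.\<close>
fun pack :: "'a list list \<Rightarrow> 'a list \<Rightarrow> nat" where
  "pack [] used = 0"
| "pack (c # cs) used =
     (if \<forall>x \<in> set c. x \<notin> set used then Suc (pack cs (c @ used)) else pack cs used)"

lemma pack_le_card:
  assumes "finite R" "\<And>c. c \<in> set cs \<Longrightarrow> set c \<inter> R \<noteq> {}"
  shows "pack cs used \<le> card (R - set used)"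
  using assms(2)
proof (induction cs arbitrary: used)
  case (Cons c cs)
  show ?case
  proof (cases "\<forall>x \<in> set c. x \<notin> set used")
    case True
    have "set c \<inter> R \<noteq> {}" using Cons.prems by simp
    then obtain x where x: "x \<in> set c" "x \<in> R" by blast
    have "pack cs (c @ used) \<le> card (R - set (c @ used))"
      by (rule Cons.IH) (use Cons.prems in simp)
    also have "\<dots> < card (R - set used)"
      by (rule psubset_card_mono) (use x True assms(1) in auto)
    finally show ?thesis using True by simp
  next
    case False
    then show ?thesis using Cons by auto
  qed
qed simp

text \<open>A hitting set as small as a packing has exactly one point in each of the packed sets and
  none elsewhere: an outside point could be dropped, and the rest would be too small.\<close>
lemma hitting_set_within_packing:
  assumes "finite R" "\<And>c. c \<in> set cs \<Longrightarrow> set c \<inter> R \<noteq> {}" "card R \<le> pack cs []"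
  shows "R \<subseteq> set (concat cs)"
proof
  fix x assume x: "x \<in> R"
  show "x \<in> set (concat cs)"
  proof (rule ccontr)
    assume nx: "x \<notin> set (concat cs)"
    have "pack cs [] \<le> card (R - {x} - set [])"
    proof (rule pack_le_card)
      fix c assume c: "c \<in> set cs"
      then have "x \<notin> set c" using nx by auto
      then show "set c \<inter> (R - {x}) \<noteq> {}" using assms(2)[OF c] by blast
    qed (use assms(1) in simp)
    also have "\<dots> < card R" using psubset_card_mono[OF assms(1), of "R - {x}"] x by auto
    finally show False using assms(3) by simp
  qed
qed

section \<open>Dimensions up to three\<close>

lemma card_dim0: "line_free 0 A \<Longrightarrow> card A \<le> 1"
  using card_mono[OF finite_cube line_free_subset, of 0 A] by (simp add: card_cube)

lemma card_dim1:
  assumes "line_free 1 A"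
  shows "card A \<le> 2"
proof -
  have "A \<noteq> cube 1"
  proof
    assume A: "A = cube 1"
    have w: "[None] \<in> templates 1" by (auto simp: templates_def)
    show False using line_free_missing[OF assms w] line_points_in_cube[OF w] A by blast
  qed
  then have "A \<subset> cube 1" using line_free_subset[OF assms] by blast
  then show ?thesis using psubset_card_mono[OF finite_cube, of A 1] by (simp add: card_cube)
qed

lemma card_dim2: "line_free 2 A \<Longrightarrow> card A \<le> 6"
  using card_le_three_times[of 2 A 2] card_dim1 by simp

lemma card_dim3: "line_free 3 A \<Longrightarrow> card A \<le> 18"
  using card_le_three_times[of 3 A 6] card_dim2 by simp

text \<open>The line-free sets of six points in the plane: the three sets avoiding a residue, and the
  set of all words with two different letters.\<close>
definition hexads :: "nat list list list" where
  "hexads = map (\<lambda>j. filter (\<lambda>v. residue v \<noteq> j) (words 2)) [0, 1, 2] @ [filter (\<lambda>v. v ! 0 \<noteq> v ! 1) (words 2)]"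

text \<open>A list of points is line-free exactly if none of its points is blocked by the others, so the
  plane sets with at least six points can be enumerated.\<close>
lemma hexad_check:
  "\<forall>xs \<in> set (subseqs (words 2)). length xs < 6 \<or> xs \<in> set hexads \<or>
     (\<exists>z \<in> set xs. z \<notin> set (unblocked (\<lambda>x. x \<in> set xs) xs))"
  by code_simp

lemma filter_in_subseqs: "filter P xs \<in> set (subseqs xs)"
  by (induction xs) (auto simp: Let_def)

lemma six_point_plane:
  assumes lf: "line_free 2 A" and c: "6 \<le> card A"
  obtains E where "E \<in> set hexads" "A = set E"
proof
  let ?E = "filter (\<lambda>v. v \<in> A) (words 2)"
  have A: "A = set ?E" using line_free_subset[OF lf] by (auto simp: set_words)
  show "A = set ?E" by (fact A)
  have "length ?E = card A" using A distinct_words[of 2] distinct_card distinct_filter by metis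
  moreover have "?E \<in> set (subseqs (words 2))" by (rule filter_in_subseqs)
  moreover have "z \<in> set (unblocked (\<lambda>x. x \<in> set ?E) ?E)" if "z \<in> set ?E" for z
    by (rule mem_unblocked[OF lf]) (use that A in auto)
  ultimately show "?E \<in> set hexads" using hexad_check c by (metis not_less)
qed

text \<open>The points of the face with first letter \<open>c\<close> that do not complete a line together with given
  parallel faces at the letters \<open>a\<close> and \<open>b\<close>.\<close>
definition completions :: "nat \<Rightarrow> nat \<Rightarrow> nat \<Rightarrow> nat list list \<Rightarrow> nat list list \<Rightarrow> nat list list" where
  "completions a b c E F = unblocked (\<lambda>x. x \<in> set (map ((#) a) E @ map ((#) b) F)) (map ((#) c) (words 2))"

lemma completion_check:
  "\<forall>(a, b, c) \<in> {(1, 2, 3), (1, 3, 2), (2, 3, 1)}. \<forall>E \<in> set hexads. \<forall>F \<in> set hexads.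
     length (completions a b c E F) < 5 \<or>
     (\<exists>j \<in> {0, 1, 2}. \<forall>v \<in> set (map ((#) a) E @ map ((#) b) F @ completions a b c E F). residue v \<noteq> j)"
  by code_simp

text \<open>Two parallel faces of six points have one of only four shapes each. Lines across the three
  faces then exclude so many points of the third face that it can hold five points only if the whole
  set avoids a residue.\<close>
lemma two_hexad_slices_avoid_residue:
  assumes lf: "line_free 3 A" and abc: "(a, b, c) \<in> {(1, 2, 3), (1, 3, 2), (2, 3, 1)}"
    and six: "6 \<le> card (slice 0 a A)" "6 \<le> card (slice 0 b A)" and five: "5 \<le> card (slice 0 c A)"
  shows "\<exists>j < 3. avoids j A"
proof -
  have ab: "a \<in> {1, 2, 3}" "b \<in> {1, 2, 3}" "c \<in> {1, 2, 3}" using abc by auto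
  have lfs: "line_free 2 (slice 0 e A)" if "e \<in> {1, 2, 3}" for e
    using line_free_slice[OF lf _ that, of 0] by simp
  have sl: "v \<in> slice 0 e A \<longleftrightarrow> e # v \<in> A" for e v by (simp add: slice_def ins_def)
  obtain E where E: "E \<in> set hexads" "slice 0 a A = set E" using six_point_plane[OF lfs[OF ab(1)] six(1)] .
  obtain F where F: "F \<in> set hexads" "slice 0 b A = set F" using six_point_plane[OF lfs[OF ab(2)] six(2)] .
  let ?K = "map ((#) a) E @ map ((#) b) F" let ?U = "completions a b c E F"
  have K: "set ?K \<subseteq> A" using E(2) F(2) sl by auto
  have U: "c # v \<in> set ?U" if "v \<in> slice 0 c A" for v
    unfolding completions_def
  proof (rule mem_unblocked[OF lf])
    show "x \<in> A" if "x \<in> set ?K" for x using that K by blast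
    show "c # v \<in> A" using that sl by simp
    show "c # v \<in> set (map ((#) c) (words 2))"
      using that lfs[OF ab(3)] line_free_subset by (auto simp: set_words)
  qed
  have "card (slice 0 c A) = card ((#) c ` slice 0 c A)" by (simp add: card_image)
  also have "\<dots> \<le> card (set ?U)" by (rule card_mono) (use U in auto)
  also have "\<dots> \<le> length ?U" by (rule card_length)
  finally have "\<not> length ?U < 5" using five by simp
  moreover have "\<forall>E \<in> set hexads. \<forall>F \<in> set hexads. length (completions a b c E F) < 5 \<or>
     (\<exists>j \<in> {0, 1, 2}. \<forall>v \<in> set (map ((#) a) E @ map ((#) b) F @ completions a b c E F). residue v \<noteq> j)"
    using bspec[OF completion_check abc] by simp
  ultimately have "\<exists>j \<in> {0, 1, 2}. \<forall>v \<in> set (map ((#) a) E @ map ((#) b) F @ ?U). residue v \<noteq> j"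
    using E(1) F(1) by blast
  then obtain j where "j \<in> {0, 1, 2}" and
    av: "\<forall>v \<in> set (map ((#) a) E @ map ((#) b) F @ ?U). residue v \<noteq> j" ..
  then have j: "j < 3" by auto
  have "v \<in> set (map ((#) a) E @ map ((#) b) F @ ?U)" if v: "v \<in> A" for v
  proof -
    obtain e u where eu: "v = e # u" "e \<in> {1, 2, 3}"
      using v line_free_subset[OF lf] by (cases v) (auto simp: cube_def)
    then have "e = a \<or> e = b \<or> e = c" using abc by auto
    then show ?thesis using U[of u] E(2) F(2) sl[of u] v eu by auto
  qed
  then show ?thesis using j av unfolding avoids_def by blast
qed

text \<open>Since faces have at most six points, the sizes of three parallel ones are 6, 6 and at least 5
  in some order.\<close>
lemma seventeen_points_avoid_residue:
  assumes lf: "line_free 3 A" and c: "17 \<le> card A"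
  shows "\<exists>j < 3. avoids j A"
proof -
  have le: "card (slice 0 a A) \<le> 6" if "a \<in> {1, 2, 3}" for a
    using line_free_slice[OF lf _ that, of 0] card_dim2 by simp
  have eq: "card (face 0 a A) = card (slice 0 a A)" for a
    using card_face[OF line_free_subset[OF lf], of 0 a] by simp
  have sum: "card A = card (slice 0 1 A) + card (slice 0 2 A) + card (slice 0 3 A)"
    using card_faces[OF line_free_subset[OF lf], of 0] eq by simp
  obtain a b e where abe: "(a, b, e) \<in> {(1, 2, 3), (1, 3, 2), (2, 3, 1)}"
    "6 \<le> card (slice 0 a A)" "6 \<le> card (slice 0 b A)" "5 \<le> card (slice 0 e A)"
  proof -
    consider "6 \<le> card (slice 0 1 A)" "6 \<le> card (slice 0 2 A)" "5 \<le> card (slice 0 3 A)"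
      | "6 \<le> card (slice 0 1 A)" "6 \<le> card (slice 0 3 A)" "5 \<le> card (slice 0 2 A)"
      | "6 \<le> card (slice 0 2 A)" "6 \<le> card (slice 0 3 A)" "5 \<le> card (slice 0 1 A)"
      using le[of 1] le[of 2] le[of 3] sum c by fastforce
    then show ?thesis using that by cases blast+
  qed
  show ?thesis by (rule two_hexad_slices_avoid_residue[OF lf abe])
qed

section \<open>Four dimensions\<close>

text \<open>The possible sets of words of the avoided residue are characterised by a condition on pairs, so
  they are the cliques of a graph, and enumerating cliques is much shorter than enumerating all
  subsets.\<close>
fun cliques :: "('a \<Rightarrow> 'a \<Rightarrow> bool) \<Rightarrow> 'a list \<Rightarrow> 'a list list" where
  "cliques C [] = [[]]"
| "cliques C (p # ps) = cliques C ps @ map ((#) p) (cliques C (filter (C p) ps))"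

lemma filter_in_cliques:
  assumes "\<And>p q. p \<in> set ps \<Longrightarrow> q \<in> set ps \<Longrightarrow> P p \<Longrightarrow> P q \<Longrightarrow> C p q"
  shows "filter P ps \<in> set (cliques C ps)"
  using assms
proof (induction "length ps" arbitrary: ps rule: less_induct)
  case less
  show ?case
  proof (cases ps)
    case (Cons p qs)
    have "filter P qs \<in> set (cliques C qs)" using less Cons by simp
    moreover have "filter P (filter (C p) qs) \<in> set (cliques C (filter (C p) qs))"
      by (rule less.hyps) (use less.prems Cons in \<open>auto simp: le_imp_less_Suc\<close>)
    moreover have "filter P (filter (C p) qs) = filter P qs" if "P p"
      unfolding filter_filter by (rule filter_cong) (use less(2) Cons that in auto)
    ultimately show ?thesis using Cons by auto
  qed simp
qed

text \<open>Two words of residue \<open>j\<close> in the same large set can differ at a position only if both letters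
  there are distinct from \<open>j\<close> modulo 3: the two faces through these words are small, and then the third
  parallel face is full, which forces its letter to be congruent to \<open>j\<close>.\<close>
definition compatible :: "nat \<Rightarrow> nat list \<Rightarrow> nat list \<Rightarrow> bool" where
  "compatible j p q \<longleftrightarrow> list_all2 (\<lambda>a b. a = b \<or> a mod 3 \<noteq> j \<and> b mod 3 \<noteq> j) p q"

text \<open>The lines with three wildcards. Those whose fixed letter is not congruent to \<open>j\<close> lie entirely
  outside residue \<open>j\<close>, so that each of them misses a point of \<open>A\<close> whatever the words of residue \<open>j\<close>
  in \<open>A\<close> are.\<close>
definition one_letter_templates :: "nat option list list" where
  "one_letter_templates =
     concat (map (\<lambda>c. map (\<lambda>k. (replicate 4 None)[k := Some c]) [0, 1, 2, 3]) [1, 2, 3])"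

text \<open>At these positions two words of \<open>Q\<close> differ, so by the remark on compatibility all words with
  a letter congruent to \<open>j\<close> there, and of residue other than \<open>j\<close>, are known to be present.\<close>
definition varying :: "nat list list \<Rightarrow> nat list" where
  "varying Q = filter (\<lambda>k. \<exists>p \<in> set Q. p ! k \<noteq> hd Q ! k) [0, 1, 2, 3]"

text \<open>Here \<open>Q\<close> is the set of all words of residue \<open>j\<close> in a line-free set \<open>A\<close>. A line
  all of whose points of residue \<open>j\<close> lie in \<open>Q\<close> must miss \<open>A\<close> at a point of another
  residue, and not at a point known to be present because of one of the positions \<open>ks\<close>. The
  remaining candidates for the missing point form one demand.\<close>
definition demands :: "nat \<Rightarrow> nat list list \<Rightarrow> nat list \<Rightarrow> nat list list list" where
  "demands j Q ks =
     map (filter (\<lambda>x. x \<notin> set Q \<and> (\<forall>k \<in> set ks. x ! k mod 3 \<noteq> j)))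
       (filter (\<lambda>L. \<forall>x \<in> set L. residue x = j \<longrightarrow> x \<in> set Q)
         (map line_points (concat (map lines_through Q) @ one_letter_templates)))"

text \<open>Short demands leave the least choice, and serving them first makes the greedy packing large
  enough.\<close>
definition by_length :: "'a list list \<Rightarrow> 'a list list" where
  "by_length cs = concat (map (\<lambda>l. filter (\<lambda>c. length c = l) cs) [0, 1, 2, 3])"

text \<open>The six arrangements of the multiset in which each of the two letters other than \<open>j\<close> occurs
  twice.\<close>
definition balanced :: "nat \<Rightarrow> nat list list" where
  "balanced j = filter (\<lambda>v. residue v = j \<and> (\<forall>a \<in> set v. a mod 3 \<noteq> j)) (words 4)"

text \<open>With 54 words outside residue \<open>j\<close>, a packing of size \<open>m\<close> leaves at most \<open>54 - m + length Q\<close>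
  points. This is below 50 in the first case and equal to 50 in the second.\<close>
fun large_packing :: "nat \<Rightarrow> nat list list \<Rightarrow> nat \<Rightarrow> bool" where
  "large_packing j Q m \<longleftrightarrow> 4 + length Q < m \<or> (4 + length Q = m \<and> Q = balanced j)"

definition packing_bound :: "nat \<Rightarrow> nat list list \<Rightarrow> bool" where
  "packing_bound j Q \<longleftrightarrow>
     Q = [] \<or> large_packing j Q (pack (by_length (demands j Q (varying Q))) [])"

lemma packing_check:
  "list_all (packing_bound 0) (cliques (compatible 0) (filter (\<lambda>v. residue v = 0) (words 4)))"
  "list_all (packing_bound 1) (cliques (compatible 1) (filter (\<lambda>v. residue v = 1) (words 4)))"
  "list_all (packing_bound 2) (cliques (compatible 2) (filter (\<lambda>v. residue v = 2) (words 4)))"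
  by (code_simp, code_simp, code_simp)

text \<open>The core contains the balanced words and, among the words of residue other than \<open>j\<close>, those with
  some letter congruent to \<open>j\<close>.\<close>
definition in_core :: "nat \<Rightarrow> nat list \<Rightarrow> bool" where
  "in_core j v \<longleftrightarrow> (residue v = j \<longleftrightarrow> (\<forall>a \<in> set v. a mod 3 \<noteq> j))"

text \<open>The core has 50 elements, so an exceptional line-free set is the core itself; the two properties listed
  are those from which the argument in dimension 5 proceeds.\<close>
definition exceptional :: "nat \<Rightarrow> nat list set \<Rightarrow> bool" where
  "exceptional j A \<longleftrightarrow> card A \<le> 50 \<and> (\<forall>v \<in> cube 4. in_core j v \<longrightarrow> v \<in> A)"

text \<open>There are just 18 words avoiding a given residue, and the line with three wildcards consists of
  words of residue 0.\<close>
lemma eighteen_points_full: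
  assumes lf: "line_free 3 A" and c: "18 \<le> card A" and j: "j < 3" "avoids j A"
  shows "j = 0 \<and> A = {v \<in> cube 3. residue v \<noteq> j}"
proof -
  have sub: "A \<subseteq> {v \<in> cube 3. residue v \<noteq> j}"
    using j(2) line_free_subset[OF lf] by (auto simp: avoids_def)
  have "card {v \<in> cube 3. residue v \<noteq> j} = 18" using card_avoiding_class[OF j(1), of 3] by simp
  then have eq: "A = {v \<in> cube 3. residue v \<noteq> j}"
    using card_seteq[OF _ sub] c finite_cube[of 3] by simp
  have w: "[None, None, None] \<in> templates 3" by (auto simp: templates_def)
  obtain x where "x \<in> set (line_points [None, None, None])" "x \<notin> A" using line_free_missing[OF lf w] .
  moreover have "residue x = 0" using calculation(1) by (auto simp: line_points_def subst_wildcard_def residue_def)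
  ultimately show ?thesis using line_points_in_cube[OF w] eq by auto
qed

text \<open>The balance of the whole argument: compared with the set of all words avoiding residue \<open>j\<close>,
  the set \<open>A\<close> gains its words of residue \<open>j\<close> and loses the missing words of other residues.\<close>
lemma card_decomposition:
  assumes A: "A \<subseteq> cube n" and j: "j < 3" and n: "0 < n"
  shows "card A + card {v \<in> cube n. residue v \<noteq> j \<and> v \<notin> A} = 2 * 3 ^ (n - 1) + card {v \<in> A. residue v = j}"
proof -
  have fin: "finite A" using A finite_cube finite_subset by blast
  have "card A = card ({v \<in> A. residue v = j} \<union> {v \<in> A. residue v \<noteq> j})" by (rule arg_cong[of _ _ card]) auto
  also have "\<dots> = card {v \<in> A. residue v = j} + card {v \<in> A. residue v \<noteq> j}"
    by (rule card_Un_disjoint) (use fin in auto)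
  finally have 1: "card A = card {v \<in> A. residue v = j} + card {v \<in> A. residue v \<noteq> j}" .
  have "2 * 3 ^ (n - 1) = card {v \<in> cube n. residue v \<noteq> j}" using card_avoiding_class[OF j n] by simp
  also have "\<dots> = card ({v \<in> A. residue v \<noteq> j} \<union> {v \<in> cube n. residue v \<noteq> j \<and> v \<notin> A})"
    by (rule arg_cong[of _ _ card]) (use A in auto)
  also have "\<dots> = card {v \<in> A. residue v \<noteq> j} + card {v \<in> cube n. residue v \<noteq> j \<and> v \<notin> A}"
    by (rule card_Un_disjoint) (use fin finite_cube[of n] in auto)
  finally show ?thesis using 1 by simp
qed

lemma one_letter_templates_subset: "set one_letter_templates \<subseteq> templates 4"
proof -
  have "\<forall>w \<in> set one_letter_templates.
      length w = 4 \<and> set w \<subseteq> {None, Some 1, Some 2, Some 3} \<and> None \<in> set w"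
    by code_simp
  then show ?thesis by (auto simp: templates_def)
qed

lemma demands_met:
  assumes lf: "line_free 4 A" and Q: "\<And>v. v \<in> set Q \<longleftrightarrow> v \<in> A \<and> residue v = j"
    and full: "\<And>k v. k \<in> set ks \<Longrightarrow> v \<in> cube 4 \<Longrightarrow> residue v \<noteq> j \<Longrightarrow> v ! k mod 3 = j \<Longrightarrow> v \<in> A"
    and c: "c \<in> set (demands j Q ks)"
  shows "set c \<inter> {v \<in> cube 4. residue v \<noteq> j \<and> v \<notin> A} \<noteq> {}"
proof -
  obtain w where w: "w \<in> set (concat (map lines_through Q)) \<union> set one_letter_templates"
    and in_Q: "\<forall>x \<in> set (line_points w). residue x = j \<longrightarrow> x \<in> set Q"
    and ceq: "c = filter (\<lambda>x. x \<notin> set Q \<and> (\<forall>k \<in> set ks. x ! k mod 3 \<noteq> j)) (line_points w)"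
    using c unfolding demands_def by auto
  have t: "w \<in> templates 4"
    using w lines_through_templates one_letter_templates_subset Q line_free_subset[OF lf] by auto
  obtain x where x: "x \<in> set (line_points w)" "x \<notin> A" using line_free_missing[OF lf t] .
  have cube: "x \<in> cube 4" using x line_points_in_cube[OF t] by blast
  have nQ: "x \<notin> set Q" using x(2) Q by blast
  then have res: "residue x \<noteq> j" using x(1) in_Q by blast
  have "x ! k mod 3 \<noteq> j" if "k \<in> set ks" for k using full[OF that cube res] x(2) by blast
  then have "x \<in> set c" using x(1) nQ ceq by simp
  then show ?thesis using cube res x(2) by blast
qed

lemma set_by_length: "set (by_length cs) \<subseteq> set cs"
  by (auto simp: by_length_def)

text \<open>In each direction, either two parallel faces have at least 17 points and so avoid the common
  residue \<open>j\<close>, or the sizes are 18, 16 and 16 and the face of 18 points is full. Hence the words of residue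
  \<open>j\<close> in \<open>A\<close> agree in every direction of the first kind, and they are pairwise compatible. The
  enumeration of cliques then shows that, unless there are none of them or exactly the balanced
  ones, they cost too many other words.\<close>
lemma fifty_points_dim4:
  assumes lf: "line_free 4 A" and c: "50 \<le> card A"
  shows "\<exists>j < 3. avoids j A \<or> exceptional j A"
proof -
  have A: "A \<subseteq> cube 4" using line_free_subset[OF lf] .
  have sum: "card A = card (face k 1 A) + card (face k 2 A) + card (face k 3 A)" if "k < 4" for k
    using card_faces[OF A that] .
  have lfs: "line_free 3 (slice k a A)" if "k < 4" "a \<in> {1, 2, 3}" for k a
    using line_free_slice[OF lf that] by simp
  have cs: "card (slice k a A) = card (face k a A)" if "k < 4" for k a
    using card_face[OF A that] by simp
  have big_avoids: "\<exists>j < 3. avoids j (face k a A)" if k: "k < 4" and a: "a \<in> {1, 2, 3}" and big: "17 \<le> card (face k a A)" for k a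
  proof -
    obtain i where "i < 3" "avoids i (slice k a A)"
      using seventeen_points_avoid_residue[OF lfs[OF k a]] cs[OF k] big by auto
    then have "avoids ((i + a) mod 3) (face k a A)" using face_avoids_of_slice[OF A k] by simp
    then show ?thesis by (intro exI[of _ "(i + a) mod 3"]) simp
  qed
  have ex: "\<exists>a \<in> {1, 2, 3}. \<exists>j < 3. 17 \<le> card (face k a A) \<and> avoids j (face k a A)" if k: "k < 4" for k
  proof -
    have "\<exists>a \<in> {1, 2, 3}. 17 \<le> card (face k a A)"
    proof (rule ccontr)
      assume "\<not> ?thesis"
      then have "card (face k 1 A) \<le> 16" "card (face k 2 A) \<le> 16" "card (face k 3 A) \<le> 16" by auto
      then show False using sum[OF k] c by simp
    qed
    then show ?thesis using big_avoids[OF k] by blast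
  qed
  obtain j where j: "j < 3" and uniform: "\<And>k a j'. k < 4 \<Longrightarrow> a \<in> {1, 2, 3} \<Longrightarrow> 17 \<le> card (face k a A)
      \<Longrightarrow> j' < 3 \<Longrightarrow> avoids j' (face k a A) \<Longrightarrow> avoids j (face k a A)"
    \<comment> \<open>The faces overlap enough because \<open>2 * 6 + 3 < 17\<close>.\<close>
    by (rule uniform_residue[OF lf, of 6 17]) (use card_dim2 ex in auto)
  have small: "card (face k (p ! k) A) \<le> 16" "p ! k \<in> {1, 2, 3}" if "k < 4" "p \<in> A" "residue p = j" for k p
  proof -
    show p: "p ! k \<in> {1, 2, 3}" using cube_nth that A by blast
    have "\<not> avoids j (face k (p ! k) A)" using that by (auto simp: avoids_def face_def)
    then have "\<not> 17 \<le> card (face k (p ! k) A)"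
      using big_avoids[OF that(1) p] uniform[OF that(1) p] by blast
    then show "card (face k (p ! k) A) \<le> 16" by simp
  qed
  have full: "p ! k mod 3 \<noteq> j \<and> q ! k mod 3 \<noteq> j \<and> (\<forall>v \<in> cube 4. residue v \<noteq> j \<longrightarrow> v ! k mod 3 = j \<longrightarrow> v \<in> A)"
    if k: "k < 4" and p: "p \<in> A" "residue p = j" and q: "q \<in> A" "residue q = j" and pq: "p ! k \<noteq> q ! k" for k p q
  proof -
    \<comment> \<open>The letter of the third parallel face, as the letters are 1, 2 and 3.\<close>
    let ?b = "6 - p ! k - q ! k"
    note pl = small[OF k p] and ql = small[OF k q]
    have b: "?b \<in> {1, 2, 3}" "?b \<noteq> p ! k" "?b \<noteq> q ! k" using pl(2) ql(2) pq by auto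
    have "card A = card (face k (p ! k) A) + card (face k (q ! k) A) + card (face k ?b A)"
      using sum[OF k] pl(2) ql(2) pq by auto
    then have c18: "18 \<le> card (face k ?b A)" using c pl(1) ql(1) by linarith
    then have "avoids j (face k ?b A)" using big_avoids[OF k b(1)] uniform[OF k b(1)] by auto
    then have "avoids ((j + 2 * ?b) mod 3) (slice k ?b A)" using slice_avoids_iff[OF A k j] by simp
    then have z: "(j + 2 * ?b) mod 3 = 0" and sl: "slice k ?b A = {v \<in> cube 3. residue v \<noteq> 0}"
      using eighteen_points_full[OF lfs[OF k b(1)], of "(j + 2 * ?b) mod 3"] c18 cs[OF k] by auto
    have bj: "?b mod 3 = j" using mod3_cancel(2)[of ?b j] z j by simp
    have inj: "x = y" if "x \<in> {1, 2, 3}" "y \<in> {1, 2, 3}" "x mod 3 = y mod 3" for x y :: nat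
      using that by auto
    have "v \<in> A" if v: "v \<in> cube 4" "residue v \<noteq> j" "v ! k mod 3 = j" for v
    proof -
      have "v ! k = ?b" using inj[OF cube_nth[OF v(1) k] b(1)] v(3) bj by simp
      then have vi: "ins k ?b (del k v) = v" using ins_del[of k v] cube_length[OF v(1)] k by simp
      then have "residue (del k v) \<noteq> 0" using v(2) residue_ins_iff[OF j, of k ?b "del k v"] z by simp
      moreover have "del k v \<in> cube 3"
        using vi slice_in_cube[of "cube 4" 4 k ?b] v(1) by (auto simp: slice_def)
      ultimately have "del k v \<in> slice k ?b A" unfolding sl by simp
      then show ?thesis by (simp only: slice_def mem_Collect_eq vi)
    qed
    moreover have "p ! k mod 3 \<noteq> j" "q ! k mod 3 \<noteq> j" using inj b pl(2) ql(2) bj by metis+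
    ultimately show ?thesis by blast
  qed
  let ?bad = "filter (\<lambda>v. residue v = j) (words 4)"
  define Q where "Q = filter (\<lambda>v. v \<in> A) ?bad"
  have Q: "v \<in> set Q \<longleftrightarrow> v \<in> A \<and> residue v = j" for v using A by (auto simp: Q_def set_words)
  have clique: "Q \<in> set (cliques (compatible j) ?bad)"
    unfolding Q_def
  proof (rule filter_in_cliques)
    fix p q assume pq: "p \<in> set ?bad" "q \<in> set ?bad" "p \<in> A" "q \<in> A"
    have len: "length p = 4" "length q = 4" using pq A cube_length by blast+
    show "compatible j p q"
      unfolding compatible_def list_all2_conv_all_nth using len full[of _ p q] pq by auto
  qed
  have "{v \<in> A. residue v = j} = set Q" using Q by blast
  then have cQ: "card {v \<in> A. residue v = j} = length Q"
    using distinct_card[of Q] distinct_words[of 4] by (simp add: Q_def)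
  define R where "R = {v \<in> cube 4. residue v \<noteq> j \<and> v \<notin> A}"
  have R: "card A + card R = 54 + length Q"
    using card_decomposition[OF A j] cQ by (simp add: R_def)
  have finR: "finite R" using finite_cube by (simp add: R_def)
  let ?D = "demands j Q (varying Q)"
  have hit: "set c \<inter> R \<noteq> {}" if "c \<in> set (by_length ?D)" for c
    unfolding R_def
  proof (rule demands_met[OF lf Q])
    show "c \<in> set ?D" using that set_by_length by blast
    fix k v assume k: "k \<in> set (varying Q)" and v: "v \<in> cube 4" "residue v \<noteq> j" "v ! k mod 3 = j"
    obtain p where p: "p \<in> set Q" "p ! k \<noteq> hd Q ! k" "k < 4" using k unfolding varying_def set_filter by auto
    moreover have "hd Q \<in> set Q" using p(1) by (cases Q) auto
    ultimately show "v \<in> A" using full[of k p "hd Q"] Q v by blast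
  qed
  have pack: "pack (by_length ?D) [] \<le> card R"
    using pack_le_card[OF finR hit, of "by_length ?D" "[]"] by simp
  have "j \<in> {0, 1, 2}" using j by auto
  then have "list_all (packing_bound j) (cliques (compatible j) ?bad)"
    using packing_check by blast
  then have "Q = [] \<or> large_packing j Q (pack (by_length ?D) [])"
    using clique unfolding list_all_iff packing_bound_def by blast
  then consider "Q = []" | "4 + length Q < pack (by_length ?D) []"
    | "4 + length Q = pack (by_length ?D) []" "Q = balanced j" by auto
  then show ?thesis
  proof cases
    case 1
    then have "avoids j A" using Q by (auto simp: avoids_def)
    then show ?thesis using j by blast
  next
    case 2
    then show ?thesis using pack R c by linarith
  next
    case 3
    have bal: "v \<in> set (balanced j) \<longleftrightarrow> v \<in> cube 4 \<and> residue v = j \<and> (\<forall>a \<in> set v. a mod 3 \<noteq> j)" for v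
      by (auto simp: balanced_def set_words)
    have "exceptional j A"
      unfolding exceptional_def
    proof (intro conjI ballI impI)
      show "card A \<le> 50" using 3 pack R by linarith
      fix v assume v: "v \<in> cube 4" and core: "in_core j v"
      then have iff: "residue v = j \<longleftrightarrow> (\<forall>a \<in> set v. a mod 3 \<noteq> j)" by (simp add: in_core_def)
      show "v \<in> A"
      proof (cases "residue v = j")
        case True
        then show ?thesis using iff v bal Q 3 by blast
      next
        case False
        then obtain k where k: "k < 4" "v ! k mod 3 = j"
          using iff cube_length[OF v] by (metis in_set_conv_nth)
        have "\<forall>j \<in> {0, 1, 2}. \<forall>k \<in> {0, 1, 2, 3}. \<exists>p \<in> set (balanced j). \<exists>q \<in> set (balanced j). p ! k \<noteq> q ! k"
          by code_simp
        moreover have "k \<in> {0, 1, 2, 3}" using k by auto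
        ultimately obtain p q where "p \<in> set (balanced j)" "q \<in> set (balanced j)" "p ! k \<noteq> q ! k"
          using \<open>j \<in> {0, 1, 2}\<close> by blast
        then show ?thesis using full[OF k(1), of p q] 3 Q v False k by blast
      qed
    qed
    then show ?thesis using j by blast
  qed
qed

lemma card_dim4:
  assumes lf: "line_free 4 A"
  shows "card A \<le> 52"
proof (rule ccontr)
  assume "\<not> ?thesis"
  then have c: "53 \<le> card A" by simp
  then obtain j where j: "j < 3" "avoids j A"
    using fifty_points_dim4[OF lf] by (auto simp: exceptional_def)
  let ?R = "{v \<in> cube 4. residue v \<noteq> j \<and> v \<notin> A}"
  have "pack (demands j [] []) [] \<le> card (?R - set [])"
  proof (rule pack_le_card)
    show "set c \<inter> ?R \<noteq> {}" if "c \<in> set (demands j [] [])" for c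
      by (rule demands_met[OF lf _ _ that]) (use j(2) in \<open>auto simp: avoids_def\<close>)
  qed (simp add: finite_cube)
  moreover have "\<forall>j \<in> {0, 1, 2}. 2 \<le> pack (demands j [] []) []" by code_simp
  moreover have "j \<in> {0, 1, 2}" using j by auto
  ultimately have "2 \<le> card ?R" by fastforce
  moreover have none: "{v \<in> A. residue v = j} = {}" using j by (auto simp: avoids_def)
  have "card A + card ?R = 54"
    using card_decomposition[OF line_free_subset[OF lf] j(1)] unfolding none by simp
  ultimately show False using c by simp
qed

section \<open>Five dimensions\<close>

text \<open>In dimension 5 the lines with three wildcards have two fixed letters \<open>c\<close> and \<open>d\<close>, and they avoid
  residue \<open>j\<close> if \<open>c + d\<close> is not congruent to \<open>j\<close>. For different letters, placing them at cyclic distance \<open>s\<close>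
  gives five pairwise disjoint lines; for \<open>c = d\<close> all such lines share the constant word \<open>c\<close>, and one of
  them is kept. Two pairs of each kind qualify, which makes 12 disjoint lines.\<close>
definition two_letter_lines :: "nat \<Rightarrow> nat \<Rightarrow> nat option list list" where
  "two_letter_lines j s = concat (map (\<lambda>(c, d).
     map (\<lambda>i. (replicate 5 None)[i := Some c, (i + s) mod 5 := Some d]) (if c = d then [0] else [0, 1, 2, 3, 4]))
     (filter (\<lambda>(c, d). (c + d) mod 3 \<noteq> j) [(1, 1), (1, 2), (1, 3), (2, 2), (2, 3), (3, 3)]))"

definition nearly_constant :: "nat list \<Rightarrow> bool" where
  "nearly_constant v \<longleftrightarrow> (\<exists>c \<in> {1, 2, 3}. 4 \<le> count_list v c)"

lemma two_letter_lines_check: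
  "\<forall>j \<in> {0, 1, 2}. \<forall>s \<in> {1, 2}.
     pack (map line_points (two_letter_lines j s)) [] = 12 \<and>
     (\<forall>w \<in> set (two_letter_lines j s).
        length w = 5 \<and> set w \<subseteq> {None, Some 1, Some 2, Some 3} \<and> None \<in> set w \<and>
        (\<forall>x \<in> set (line_points w). residue x \<noteq> j))"
  by code_simp

text \<open>A word that is not nearly constant lies on at most one line with three wildcards, and no line
  belongs to the packings for both distances.\<close>
lemma common_points_check:
  "\<forall>j \<in> {0, 1, 2}. \<forall>x \<in> set (concat (map line_points (two_letter_lines j 1))).
     x \<in> set (concat (map line_points (two_letter_lines j 2))) \<longrightarrow> nearly_constant x"
  by code_simp

text \<open>Every word of length 5 has a repeated letter, and changing one or two equal letters leads to
  words of the other two residues; a suitable choice stays away from nearly constant words.\<close>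
lemma far_line_check:
  "\<forall>v \<in> set (words 5). \<exists>w \<in> set (lines_through v). \<forall>x \<in> set (line_points w).
     x = v \<or> residue x \<noteq> residue v \<and> \<not> nearly_constant x"
  by code_simp

text \<open>A face of the core of an exceptional set avoids a residue only if its letter is congruent to \<open>i\<close>,
  because every other face contains balanced words, of residue \<open>i\<close>, next to words of both other
  residues; and the residue it then avoids is \<open>i\<close>.\<close>
lemma core_letter_check:
  "\<forall>i \<in> {0, 1, 2}. \<forall>k \<in> {0, 1, 2, 3}. \<forall>a \<in> {1, 2, 3}. \<forall>r \<in> {0, 1, 2}.
     (\<forall>v \<in> set (words 4). in_core i v \<longrightarrow> v ! k = a \<longrightarrow> residue v \<noteq> r) \<longrightarrow> a mod 3 = i \<and> r = i"
  by code_simp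

text \<open>The words that belong to \<open>A\<close> once every face at the letter \<open>t\<close> is exceptional for the residue of
  the letter \<open>s\<close>.\<close>
definition forced_point :: "nat \<Rightarrow> nat \<Rightarrow> nat list \<Rightarrow> bool" where
  "forced_point s t x \<longleftrightarrow> (\<exists>k \<in> {0, 1, 2, 3, 4}. x ! k = t \<and> in_core (s mod 3) (del k x))"

text \<open>If all faces at the letter \<open>s\<close> avoid the residue of \<open>s + t\<close>, the words of this residue do not
  contain \<open>s\<close>.\<close>
definition third_face_candidates :: "nat \<Rightarrow> nat \<Rightarrow> nat list list" where
  "third_face_candidates s t =
     filter (\<lambda>z. z ! 0 \<noteq> s \<and> z ! 0 \<noteq> t \<and> (residue z = (s + t) mod 3 \<longrightarrow> s \<notin> set z)) (words 5)"

lemma third_face_check: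
  "\<forall>s \<in> {1, 2, 3}. \<forall>t \<in> {1, 2, 3}. s = t \<or>
     length (unblocked (forced_point s t) (third_face_candidates s t)) \<le> 48"
  by code_simp

lemma two_letter_lines_packing:
  assumes j: "j < 3" and s: "s \<in> {1, 2}"
  shows "pack (map line_points (two_letter_lines j s)) [] = 12"
    and "w \<in> set (two_letter_lines j s) \<Longrightarrow> w \<in> templates 5 \<and> (\<forall>x \<in> set (line_points w). residue x \<noteq> j)"
proof -
  have "j \<in> {0, 1, 2}" using j by auto
  note check = bspec[OF bspec[OF two_letter_lines_check this] s]
  show "pack (map line_points (two_letter_lines j s)) [] = 12" using check by blast
  show "w \<in> templates 5 \<and> (\<forall>x \<in> set (line_points w). residue x \<noteq> j)" if "w \<in> set (two_letter_lines j s)"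
    using bspec[OF conjunct2[OF check] that] by (auto simp: templates_def)
qed

text \<open>At least 12 words must be missing to destroy the lines with three wildcards, which settles the
  case without a word of residue \<open>j\<close>. If there is one such word \<open>p\<close> and \<open>A\<close> had 151 points, exactly
  12 words would be missing. They would lie in both packings and hence be nearly constant, but
  some line through \<open>p\<close> has no other points of that kind.\<close>
lemma card_nearly_avoiding_dim5:
  assumes lf: "line_free 5 A" and j: "j < 3"
    and one: "\<And>p q. p \<in> A \<Longrightarrow> q \<in> A \<Longrightarrow> residue p = j \<Longrightarrow> residue q = j \<Longrightarrow> p = q"
  shows "card A \<le> 150"
proof (rule ccontr)
  assume "\<not> ?thesis"
  then have c: "151 \<le> card A" by simp
  have A: "A \<subseteq> cube 5" using line_free_subset[OF lf] .
  have j': "j \<in> {0, 1, 2}" using j by auto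
  define R where "R = {v \<in> cube 5. residue v \<noteq> j \<and> v \<notin> A}"
  have finR: "finite R" using finite_cube by (simp add: R_def)
  have hit: "set c \<inter> R \<noteq> {}" if "s \<in> {1, 2}" "c \<in> set (map line_points (two_letter_lines j s))" for s c
  proof -
    obtain w where w: "w \<in> set (two_letter_lines j s)" "c = line_points w" using \<open>c \<in> _\<close> by auto
    note t = two_letter_lines_packing(2)[OF j \<open>s \<in> _\<close> w(1)]
    obtain x where x: "x \<in> set (line_points w)" "x \<notin> A" using line_free_missing[OF lf conjunct1[OF t]] .
    then have "x \<in> R" using t line_points_in_cube[of w 5] by (auto simp: R_def)
    then show ?thesis using x w by auto
  qed
  have total: "card A + card R = 162 + card {v \<in> A. residue v = j}"
    using card_decomposition[OF A j] by (simp add: R_def)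
  have "12 \<le> card R"
    using pack_le_card[OF finR hit[of 1], of "map line_points (two_letter_lines j 1)" "[]"]
      two_letter_lines_packing(1)[OF j, of 1] by simp
  have "{v \<in> A. residue v = j} \<noteq> {}"
  proof
    assume none: "{v \<in> A. residue v = j} = {}"
    show False using total c \<open>12 \<le> card R\<close> unfolding none by simp
  qed
  then obtain p where p: "p \<in> A" "residue p = j" by blast
  then have "{v \<in> A. residue v = j} = {p}" using one by blast
  then have R12: "card R \<le> 12" using total c by simp
  have near: "nearly_constant x" if x: "x \<in> R" for x
  proof -
    have "R \<subseteq> set (concat (map line_points (two_letter_lines j s)))" if s: "s \<in> {1, 2}" for s
      by (rule hitting_set_within_packing[OF finR hit[OF s]])
         (use R12 two_letter_lines_packing(1)[OF j s] in auto)
    from this[of 1] this[of 2] show ?thesis using common_points_check j' x by blast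
  qed
  have "p \<in> set (words 5)" using p A by (auto simp: set_words)
  from bspec[OF far_line_check this] obtain w where w: "w \<in> set (lines_through p)"
    and far: "\<forall>x \<in> set (line_points w). x = p \<or> residue x \<noteq> residue p \<and> \<not> nearly_constant x" ..
  have t: "w \<in> templates 5" using lines_through_templates w p A by blast
  obtain x where x: "x \<in> set (line_points w)" "x \<notin> A" using line_free_missing[OF lf t] .
  moreover have "x \<in> cube 5" using x line_points_in_cube[OF t] by blast
  ultimately have "x \<in> R" "\<not> nearly_constant x" using far p by (auto simp: R_def)
  then show False using near by blast
qed

lemma exceptional_slice_determines_letter:
  assumes A: "A \<subseteq> cube 5" and ex: "exceptional r (slice i t A)" "r < 3"
    and ik: "i < 5" "k < 5" "k \<noteq> i" and t: "t \<in> {1, 2, 3}"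
    and a: "a \<in> {1, 2, 3}" "avoids j (face k a A)" and j: "j < 3"
  shows "a mod 3 = r \<and> (t + r) mod 3 = j"
proof -
  let ?k = "if k < i then k else k - 1"
  have nr: "residue v \<noteq> (j + 2 * t) mod 3" if v: "v \<in> set (words 4)" "in_core r v" "v ! ?k = a" for v
  proof -
    have vc: "v \<in> cube 4" using v(1) by (simp add: set_words)
    then have "ins i t v \<in> A" using ex(1) v(2) by (auto simp: exceptional_def slice_def)
    moreover have "ins i t v ! k = a" using nth_ins[of i v k t] ik v(3) cube_length[OF vc] by simp
    ultimately have "residue (ins i t v) \<noteq> j" using a(2) by (auto simp: avoids_def face_def)
    then show ?thesis using residue_ins_iff[OF j] by blast
  qed
  have mem: "r \<in> {0, 1, 2}" "?k \<in> {0, 1, 2, 3}" "(j + 2 * t) mod 3 \<in> {0, 1, 2}"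
    using ex(2) ik by auto
  have "a mod 3 = r \<and> (j + 2 * t) mod 3 = r"
    using bspec[OF bspec[OF bspec[OF bspec[OF core_letter_check mem(1)] mem(2)] a(1)] mem(3)] nr by blast
  then show ?thesis using mod3_cancel(2)[of t j] j by auto
qed

lemma card_third_face:
  assumes lf: "line_free 5 A" and st: "s \<in> {1, 2, 3}" "t \<in> {1, 2, 3}" "s \<noteq> t"
    and forced: "\<And>x. x \<in> cube 5 \<Longrightarrow> forced_point s t x \<Longrightarrow> x \<in> A"
    and av: "\<And>k. k < 5 \<Longrightarrow> avoids ((s + t) mod 3) (face k s A)"
  shows "card {z \<in> A. z ! 0 \<noteq> s \<and> z ! 0 \<noteq> t} \<le> 48"
proof -
  let ?U = "unblocked (forced_point s t) (third_face_candidates s t)"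
  have "{z \<in> A. z ! 0 \<noteq> s \<and> z ! 0 \<noteq> t} \<subseteq> set ?U"
  proof
    fix z assume z: "z \<in> {z \<in> A. z ! 0 \<noteq> s \<and> z ! 0 \<noteq> t}"
    then have cube: "z \<in> cube 5" using line_free_subset[OF lf] by blast
    have "s \<notin> set z" if "residue z = (s + t) mod 3"
    proof
      assume "s \<in> set z"
      then obtain k where "k < 5" "z ! k = s" using cube_length[OF cube] by (metis in_set_conv_nth)
      then show False using av[of k] z that by (auto simp: avoids_def face_def)
    qed
    then have "z \<in> set (third_face_candidates s t)"
      using z cube by (simp add: third_face_candidates_def set_words)
    then show "z \<in> set ?U" using mem_unblocked[OF lf forced] z by blast
  qed
  then have "card {z \<in> A. z ! 0 \<noteq> s \<and> z ! 0 \<noteq> t} \<le> card (set ?U)" by (rule card_mono[rotated]) simp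
  also have "\<dots> \<le> length ?U" by (rule card_length)
  also have "\<dots> \<le> 48" using bspec[OF bspec[OF third_face_check st(1)] st(2)] st(3) by simp
  finally show ?thesis .
qed

text \<open>Of three parallel faces of a set with 151 points, one has at least 51 points and another at least
  50. Call a face good if it avoids the common residue \<open>j\<close>. If every direction has two good faces,
  all words of residue \<open>j\<close> in \<open>A\<close> coincide. Otherwise some direction has an exceptional
  face. It intersects the good faces in all other directions in such a way that each of those
  directions has only one good face, at a letter determined by the exceptional face; so
  those directions have exceptional faces, too, and all the letters agree.\<close>
lemma card_dim5:
  assumes lf: "line_free 5 A"
  shows "card A \<le> 150"
proof (rule ccontr)
  assume "\<not> ?thesis"
  then have c: "151 \<le> card A" by simp
  have A: "A \<subseteq> cube 5" using line_free_subset[OF lf] .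
  have sum: "card A = card (face k 1 A) + card (face k 2 A) + card (face k 3 A)" if "k < 5" for k
    using card_faces[OF A that] .
  have lfs: "line_free 4 (slice k a A)" if "k < 5" "a \<in> {1, 2, 3}" for k a
    using line_free_slice[OF lf that] by simp
  have cs: "card (slice k a A) = card (face k a A)" if "k < 5" for k a
    using card_face[OF A that] by simp
  have le52: "card (face k a A) \<le> 52" if "k < 5" "a \<in> {1, 2, 3}" for k a
    using card_dim4[OF lfs[OF that]] cs[OF that(1)] by simp
  have fifty: "(\<exists>j < 3. avoids j (face k a A)) \<or> (\<exists>r < 3. exceptional r (slice k a A))"
    if k: "k < 5" and a: "a \<in> {1, 2, 3}" and big: "50 \<le> card (face k a A)" for k a
  proof -
    obtain i where i: "i < 3" "avoids i (slice k a A) \<or> exceptional i (slice k a A)"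
      using fifty_points_dim4[OF lfs[OF k a]] big cs[OF k] by auto
    have "avoids ((i + a) mod 3) (face k a A)" if "avoids i (slice k a A)"
      using face_avoids_of_slice[OF A k i(1) that] .
    moreover have "(i + a) mod 3 < 3" by simp
    ultimately show ?thesis using i by blast
  qed
  have two_large: "\<exists>a \<in> {1, 2, 3}. \<exists>b \<in> {1, 2, 3}. a \<noteq> b \<and> 51 \<le> card (face k a A) \<and> 50 \<le> card (face k b A)"
    if k: "k < 5" for k
  proof (rule ccontr)
    assume no: "\<not> ?thesis"
    let ?n = "\<lambda>a. card (face k a A)"
    have "?n 1 \<le> 52" "?n 2 \<le> 52" "?n 3 \<le> 52" using le52[OF k] by auto
    moreover have "\<not> (51 \<le> ?n a \<and> 50 \<le> ?n b)" if "a \<in> {1, 2, 3}" "b \<in> {1, 2, 3}" "a \<noteq> b" for a b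
      using no that by blast
    from this[of 1 2] this[of 1 3] this[of 2 1] this[of 2 3] this[of 3 1] this[of 3 2]
    have "\<not> (51 \<le> ?n 1 \<and> 50 \<le> ?n 2)" "\<not> (51 \<le> ?n 1 \<and> 50 \<le> ?n 3)" "\<not> (51 \<le> ?n 2 \<and> 50 \<le> ?n 1)"
      "\<not> (51 \<le> ?n 2 \<and> 50 \<le> ?n 3)" "\<not> (51 \<le> ?n 3 \<and> 50 \<le> ?n 1)" "\<not> (51 \<le> ?n 3 \<and> 50 \<le> ?n 2)"
      by simp_all
    ultimately show False using sum[OF k] c by linarith
  qed
  have large_avoids: "\<exists>j < 3. avoids j (face k a A)" if "k < 5" "a \<in> {1, 2, 3}" "51 \<le> card (face k a A)" for k a
  proof -
    have "\<not> exceptional r (slice k a A)" for r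
      using that(3) cs[OF that(1)] by (auto simp: exceptional_def)
    then show ?thesis using fifty[OF that(1,2)] that(3) by auto
  qed
  have ex: "\<exists>a \<in> {1, 2, 3}. \<exists>j < 3. 50 \<le> card (face k a A) \<and> avoids j (face k a A)" if k: "k < 5" for k
  proof -
    obtain a where a: "a \<in> {1, 2, 3}" "51 \<le> card (face k a A)" using two_large[OF k] by blast
    then show ?thesis using large_avoids[OF k a] by (intro bexI[OF _ a(1)]) auto
  qed
  obtain j where j: "j < 3" and uniform: "\<And>k a j'. k < 5 \<Longrightarrow> a \<in> {1, 2, 3} \<Longrightarrow> 50 \<le> card (face k a A)
      \<Longrightarrow> j' < 3 \<Longrightarrow> avoids j' (face k a A) \<Longrightarrow> avoids j (face k a A)"
    \<comment> \<open>The faces overlap enough because \<open>2 * 18 + 9 < 50\<close>.\<close>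
    by (rule uniform_residue[OF lf, of 18 50]) (use card_dim3 ex in auto)
  define G where "G k a \<longleftrightarrow> a \<in> {1, 2, 3} \<and> avoids j (face k a A)" for k a
  define E where "E k t \<longleftrightarrow> t \<in> {1, 2, 3} \<and> \<not> G k t \<and> (\<exists>r < 3. exceptional r (slice k t A))" for k t
  have G_ex: "\<exists>a. G k a" if k: "k < 5" for k
  proof -
    obtain a where a: "a \<in> {1, 2, 3}" "51 \<le> card (face k a A)" using two_large[OF k] by blast
    then have "G k a" using large_avoids[OF k a] uniform[OF k a(1)] by (auto simp: G_def)
    then show ?thesis ..
  qed
  have E_ex: "\<exists>t. E k t" if k: "k < 5" and single: "\<And>a b. G k a \<Longrightarrow> G k b \<Longrightarrow> a = b" for k
  proof -
    obtain a b where ab: "a \<in> {1, 2, 3}" "b \<in> {1, 2, 3}" "a \<noteq> b" "51 \<le> card (face k a A)" "50 \<le> card (face k b A)"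
      using two_large[OF k] by blast
    have "G k a" using large_avoids[OF k ab(1,4)] uniform[OF k ab(1)] ab by (auto simp: G_def)
    then have "\<not> G k b" using single ab(3) by blast
    then have "\<not> (\<exists>j < 3. avoids j (face k b A))" using uniform[OF k ab(2,5)] ab(2) by (auto simp: G_def)
    then have "E k b" using fifty[OF k ab(2,5)] ab(2) \<open>\<not> G k b\<close> by (auto simp: E_def)
    then show ?thesis ..
  qed
  have inj: "x = y" if "x \<in> {1, 2, 3}" "y \<in> {1, 2, 3}" "x mod 3 = y mod 3" for x y :: nat
    using that by auto
  have letters: "a mod 3 = r \<and> (t + r) mod 3 = j"
    if "exceptional r (slice i t A)" "r < 3" "t \<in> {1, 2, 3}" "i < 5" "k < 5" "k \<noteq> i" "G k a" for i k t r a
    using exceptional_slice_determines_letter[OF A that(1,2,4,5,6,3) _ _ j] that(7) by (auto simp: G_def)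
  have G_E: "a mod 3 = (j + 2 * t) mod 3" if "E i t" "i < 5" "k < 5" "k \<noteq> i" "G k a" for i k t a
  proof -
    obtain r where r: "r < 3" "exceptional r (slice i t A)" "t \<in> {1, 2, 3}" using \<open>E i t\<close> by (auto simp: E_def)
    have *: "a mod 3 = r" "(t + r) mod 3 = j" using letters[OF r(2,1,3) that(2-5)] by auto
    have "(j + 2 * t) mod 3 = r mod 3" using mod3_cancel(1)[of r t] * by (simp add: add.commute)
    then show ?thesis using * r by simp
  qed
  show False
  proof (cases "\<forall>k < 5. \<exists>a b. G k a \<and> G k b \<and> a \<noteq> b")
    case True
    have "card A \<le> 150"
    proof (rule card_nearly_avoiding_dim5[OF lf j])
      fix p q assume pq: "p \<in> A" "q \<in> A" "residue p = j" "residue q = j"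
      have bad: "x ! k \<in> {1, 2, 3} \<and> \<not> G k (x ! k)" if "x \<in> A" "residue x = j" "k < 5" for x k
        using that cube_nth[of x 5 k] A by (auto simp: G_def avoids_def face_def)
      show "p = q"
      proof (rule nth_equalityI)
        show len: "length p = length q" using pq A cube_length by (metis subsetD)
        fix k assume "k < length p"
        then have k: "k < 5" using pq A cube_length[of p 5] by auto
        obtain a b where ab: "G k a" "G k b" "a \<noteq> b" using True k by blast
        then have "a \<in> {1, 2, 3}" "b \<in> {1, 2, 3}" by (auto simp: G_def)
        moreover have "p ! k \<noteq> a" "p ! k \<noteq> b" "q ! k \<noteq> a" "q ! k \<noteq> b"
          using bad[OF pq(1,3) k] bad[OF pq(2,4) k] ab by auto
        moreover have "p ! k \<in> {1, 2, 3}" "q ! k \<in> {1, 2, 3}" using bad pq k by blast+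
        ultimately show "p ! k = q ! k" using ab(3) by auto
      qed
    qed
    then show False using c by simp
  next
    case False
    then obtain i where i: "i < 5" and single: "\<And>a b. G i a \<Longrightarrow> G i b \<Longrightarrow> a = b" by blast
    obtain t0 where t0: "E i t0" using E_ex[OF i single] by auto
    have E_all: "\<exists>t. E k t" if k: "k < 5" for k
    proof (cases "k = i")
      case False
      have "a = b" if "G k a" "G k b" for a b
      proof (rule inj)
        show "a mod 3 = b mod 3" using G_E[OF t0 i k False that(1)] G_E[OF t0 i k False that(2)] by simp
      qed (use that in \<open>auto simp: G_def\<close>)
      then show ?thesis by (rule E_ex[OF k])
    qed (use t0 in blast)
    obtain t where t: "E 0 t" using E_all[of 0] by auto
    have E_t: "E k t" if k: "k < 5" for k
    proof (cases "k = 0")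
      case False
      obtain t' where t': "E k t'" using E_all[OF k] ..
      \<comment> \<open>A direction different from \<open>0\<close> and \<open>k\<close>, whose good face is compared with both.\<close>
      define m :: nat where "m = (if k = 1 then 2 else 1)"
      have m: "m < 5" "m \<noteq> 0" "m \<noteq> k" by (auto simp: m_def)
      obtain a where a: "G m a" using G_ex[OF m(1)] ..
      have "(j + 2 * t) mod 3 = (j + 2 * t') mod 3"
        using G_E[OF t _ m(1,2) a] G_E[OF t' k m(1) m(3) a] by simp
      then have "((j + 2 * t) mod 3 + t) mod 3 = ((j + 2 * t') mod 3 + t) mod 3" by simp
      then have "t mod 3 = t' mod 3" by presburger
      then have "t = t'" by (rule inj[rotated 2]) (use t t' in \<open>auto simp: E_def\<close>)
      then show ?thesis using t' by simp
    qed (use t in simp)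
    have t3: "t \<in> {1, 2, 3}" using t by (simp add: E_def)
    obtain s where s: "G 0 s" using G_ex[of 0] by auto
    have G_s: "G k s" if k: "k < 5" for k
    proof -
      obtain a where a: "G k a" using G_ex[OF k] ..
      have other: "x mod 3 = (j + 2 * t) mod 3" if "G m x" "m < 5" for m x
        using G_E[OF E_t[of "if m = 0 then 1 else 0"] _ that(2) _ that(1)] by (auto split: if_splits)
      have "a = s"
      proof (rule inj)
        show "a mod 3 = s mod 3" using other[OF a k] other[OF s] by simp
      qed (use a s in \<open>auto simp: G_def\<close>)
      then show ?thesis using a by simp
    qed
    have s3: "s \<in> {1, 2, 3}" using s by (simp add: G_def)
    have st: "s \<noteq> t" using s t by (auto simp: E_def)
    have core: "exceptional (s mod 3) (slice k t A) \<and> (s + t) mod 3 = j" if k: "k < 5" for k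
    proof -
      obtain r where r: "r < 3" "exceptional r (slice k t A)" using E_t[OF k] by (auto simp: E_def)
      have "s mod 3 = r \<and> (t + r) mod 3 = j"
        by (rule letters[OF r(2,1) t3 k, of "if k = 0 then 1 else 0"]) (use G_s in auto)
      then show ?thesis using r by (auto simp: mod_add_right_eq add.commute)
    qed
    have "card {z \<in> A. z ! 0 \<noteq> s \<and> z ! 0 \<noteq> t} \<le> 48"
    proof (rule card_third_face[OF lf s3 t3 st])
      fix x assume x: "x \<in> cube 5" and "forced_point s t x"
      then obtain k where "k \<in> {0, 1, 2, 3, 4}" and k': "x ! k = t" "in_core (s mod 3) (del k x)"
        unfolding forced_point_def by blast
      then have k: "k < 5" "x ! k = t" "in_core (s mod 3) (del k x)" by auto
      have xi: "ins k t (del k x) = x" using ins_del[of k x] k cube_length[OF x] by simp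
      then have "del k x \<in> cube 4" using slice_in_cube[of "cube 5" 5 k t] x by (auto simp: slice_def)
      then have "del k x \<in> slice k t A" using core[OF k(1)] k(3) by (auto simp: exceptional_def)
      then show "x \<in> A" using xi by (simp add: slice_def)
    next
      fix k :: nat assume k: "k < 5"
      show "avoids ((s + t) mod 3) (face k s A)" using G_s[OF k] core[OF k] by (simp add: G_def)
    qed
    moreover have "A = face 0 s A \<union> face 0 t A \<union> {z \<in> A. z ! 0 \<noteq> s \<and> z ! 0 \<noteq> t}"
      by (auto simp: face_def)
    then have "card A \<le> card (face 0 s A) + card (face 0 t A) + card {z \<in> A. z ! 0 \<noteq> s \<and> z ! 0 \<noteq> t}"
      using card_Un_le[of "face 0 s A \<union> face 0 t A" "{z \<in> A. z ! 0 \<noteq> s \<and> z ! 0 \<noteq> t}"]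
        card_Un_le[of "face 0 s A" "face 0 t A"] by simp
    moreover have "card (face 0 s A) \<le> 52" using le52[of 0 s] s3 by simp
    moreover have "card (face 0 t A) \<le> 50" using core[of 0] cs[of 0 t] by (simp add: exceptional_def)
    ultimately show False using c by linarith
  qed
qed

lemma card_dim6: "line_free 6 A \<Longrightarrow> card A \<le> 450"
  using card_le_three_times[of 6 A 150] card_dim5 by simp

section \<open>Large line-free sets\<close>

definition profile :: "nat list \<Rightarrow> nat \<times> nat \<times> nat" where
  "profile v = (count_list v 1, count_list v 2, count_list v 3)"

text \<open>Membership depends only on how often each letter occurs. Along a line with \<open>r\<close> wildcards, the three
  profiles arise from one triple by adding \<open>r\<close> to each of its entries in turn, which is
  an equilateral triangle in the grid of profiles.\<close>
definition profile_set :: "nat \<Rightarrow> (nat \<times> nat \<times> nat) list \<Rightarrow> nat list set" where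
  "profile_set n T = {v \<in> cube n. profile v \<in> set T}"

text \<open>The first two corners determine the triangle; its size is \<open>a - a'\<close>.\<close>
definition triangle_free :: "(nat \<times> nat \<times> nat) list \<Rightarrow> bool" where
  "triangle_free T \<longleftrightarrow> (\<forall>(a, b, c) \<in> set T. \<forall>(a', b', c') \<in> set T.
     a' < a \<and> b' = b + (a - a') \<and> c' = c \<longrightarrow> (a', b, c + (a - a')) \<notin> set T)"

lemma count_list_subst_wildcard:
  "count_list (subst_wildcard w i) a = count_list w (Some a) + (if i = a then count_list w None else 0)"
  by (induction w) (auto simp: subst_wildcard_def split: option.splits)

lemma line_free_profile_set:
  assumes "triangle_free T"
  shows "line_free n (profile_set n T)"
  unfolding line_free_iff
proof (intro conjI ballI notI)
  show "profile_set n T \<subseteq> cube n" by (auto simp: profile_set_def)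
next
  fix w assume w: "w \<in> templates n" and sub: "set (line_points w) \<subseteq> profile_set n T"
  let ?a = "count_list w (Some 1)" let ?b = "count_list w (Some 2)" let ?c = "count_list w (Some 3)"
  let ?r = "count_list w None"
  have "?r \<noteq> 0" using w by (auto simp: templates_def count_list_0_iff)
  have p: "(?a + ?r, ?b, ?c) \<in> set T" "(?a, ?b + ?r, ?c) \<in> set T" "(?a, ?b, ?c + ?r) \<in> set T"
    using sub by (auto simp: line_points_def profile_set_def profile_def count_list_subst_wildcard)
  have "case (?a, ?b + ?r, ?c) of (a', b', c') \<Rightarrow>
      a' < ?a + ?r \<and> b' = ?b + (?a + ?r - a') \<and> c' = ?c \<longrightarrow> (a', ?b, ?c + (?a + ?r - a')) \<notin> set T"
    using assms p(1,2) unfolding triangle_free_def by blast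
  then show False using p(3) \<open>?r \<noteq> 0\<close> by simp
qed

text \<open>The words with a given profile are the arrangements of a multiset.\<close>
lemma card_profile_class:
  assumes "a + b + c = n"
  shows "card {v \<in> cube n. profile v = (a, b, c)} = fact n div (fact a * fact b * fact c)"
proof -
  define M where "M = replicate_mset a 1 + replicate_mset b 2 + replicate_mset c (3 :: nat)"
  have count_M: "count M 1 = a" "count M 2 = b" "count M 3 = c" by (simp_all add: M_def)
  have set_M: "set_mset M \<subseteq> {1, 2, 3}" by (auto simp: M_def split: if_splits)
  have "v \<in> cube n \<and> profile v = (a, b, c) \<longleftrightarrow> mset v = M" for v
  proof
    assume v: "v \<in> cube n \<and> profile v = (a, b, c)"
    show "mset v = M"
    proof (rule multiset_eqI)
      fix x
      show "count (mset v) x = count M x"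
      proof (cases "x \<in> {1, 2, 3}")
        case True
        then show ?thesis using v count_M by (auto simp: profile_def count_mset)
      next
        case False
        then have "x \<notin> set_mset (mset v)" "x \<notin> set_mset M" using v set_M by (auto simp: cube_def)
        then show ?thesis by (simp only: not_in_iff)
      qed
    qed
  next
    assume v: "mset v = M"
    have "length v = size M" using v size_mset by metis
    moreover have "set v = set_mset M" using v set_mset_mset by metis
    moreover have "count_list v x = count M x" for x using v count_mset by metis
    ultimately show "v \<in> cube n \<and> profile v = (a, b, c)"
      using set_M assms count_M by (auto simp: cube_def profile_def M_def)
  qed
  then have "{v \<in> cube n. profile v = (a, b, c)} = permutations_of_multiset M"
    by (auto simp: permutations_of_multiset_def)
  moreover have "(\<Prod>x\<in>set_mset M. fact (count M x)) = (\<Prod>x\<in>{1, 2, 3}. fact (count M x) :: nat)"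
    by (rule prod.mono_neutral_left) (use set_M in \<open>auto simp: not_in_iff\<close>)
  moreover have "size M = n" using assms by (simp add: M_def)
  ultimately show ?thesis
    using count_M by (simp add: card_permutations_of_multiset mult.assoc)
qed

lemma card_profile_set:
  assumes "distinct T" "\<forall>(a, b, c) \<in> set T. a + b + c = n"
  shows "card (profile_set n T) = (\<Sum>(a, b, c) \<leftarrow> T. fact n div (fact a * fact b * fact c))"
proof -
  let ?C = "\<lambda>p. {v \<in> cube n. profile v = p}"
  have "profile_set n T = (\<Union>p \<in> set T. ?C p)" by (auto simp: profile_set_def)
  moreover have "card (\<Union>p \<in> set T. ?C p) = (\<Sum>p \<in> set T. card (?C p))"
    by (rule card_UN_disjoint) (use finite_cube[of n] in auto)
  ultimately have "card (profile_set n T) = (\<Sum>p \<in> set T. card (?C p))" by simp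
  also have "\<dots> = (\<Sum>(a, b, c) \<in> set T. fact n div (fact a * fact b * fact c))"
    by (rule sum.cong) (use assms(2) card_profile_class in auto)
  also have "\<dots> = (\<Sum>(a, b, c) \<leftarrow> T. fact n div (fact a * fact b * fact c))"
    using assms(1) by (simp add: sum.distinct_set_conv_list)
  finally show ?thesis .
qed

lemma c3_eqI_profiles:
  assumes "triangle_free T" "distinct T" "\<forall>(a, b, c) \<in> set T. a + b + c = n"
    and "(\<Sum>(a, b, c) \<leftarrow> T. fact n div (fact a * fact b * fact c)) = m"
    and "\<And>B. line_free n B \<Longrightarrow> card B \<le> m"
  shows "c3 n = m"
  by (rule c3_eqI[OF line_free_profile_set[OF assms(1)]])
     (use assms card_profile_set[OF assms(2,3)] in auto)

theorem theorem1p4: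
  "c3 0 = 1 \<and> c3 1 = 2 \<and> c3 2 = 6 \<and> c3 3 = 18 \<and> c3 4 = 52 \<and> c3 5 = 150 \<and> c3 6 = 450"
proof (intro conjI)
  show "c3 0 = 1"
    by (rule c3_eqI_profiles[of "[(0, 0, 0)]"])
       (code_simp, simp, simp, simp add: fact_numeral, fact card_dim0)
  show "c3 1 = 2"
    by (rule c3_eqI_profiles[of "[(0, 1, 0), (1, 0, 0)]"])
       (code_simp, simp, simp, simp add: fact_numeral, fact card_dim1)
  show "c3 2 = 6"
    by (rule c3_eqI_profiles[of "[(0, 1, 1), (0, 2, 0), (1, 0, 1), (2, 0, 0)]"])
       (code_simp, simp, simp, simp add: fact_numeral, fact card_dim2)
  show "c3 3 = 18"
    by (rule c3_eqI_profiles[of "[(0, 1, 2), (0, 2, 1), (1, 0, 2), (1, 2, 0), (2, 0, 1), (2, 1, 0)]"])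
       (code_simp, simp, simp, simp add: fact_numeral, fact card_dim3)
  \<comment> \<open>In positive dimension, all profiles used have first and second entries that are incongruent
    modulo 3, so the words avoid residue 0. Among these profiles, left out are those of the constant
    words in dimension 4, those of the constant words and of four letters 1 or 2 with one letter 3
    in dimension 5, and those of five equal letters with a different one in dimension 6.\<close>
  show "c3 4 = 52"
    by (rule c3_eqI_profiles[of "[(0, 1, 3), (0, 2, 2), (1, 0, 3), (1, 2, 1), (1, 3, 0), (2, 0, 2),
      (2, 1, 1), (3, 1, 0)]"])
       (code_simp, simp, simp, simp add: fact_numeral, fact card_dim4)
  show "c3 5 = 150"
    by (rule c3_eqI_profiles[of "[(0, 1, 4), (0, 2, 3), (1, 0, 4), (1, 2, 2), (1, 3, 1), (2, 0, 3),
      (2, 1, 2), (2, 3, 0), (3, 1, 1), (3, 2, 0)]"])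
       (code_simp, simp, simp, simp add: fact_numeral, fact card_dim5)
  show "c3 6 = 450"
    by (rule c3_eqI_profiles[of "[(1, 2, 3), (1, 3, 2), (2, 1, 3), (2, 3, 1), (3, 1, 2), (3, 2, 1),
      (0, 2, 4), (0, 4, 2), (2, 0, 4), (2, 4, 0), (4, 0, 2), (4, 2, 0)]"])
       (code_simp, simp, simp, simp add: fact_numeral, fact card_dim6)
qed

end
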